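(* Let $n\ge 2$, let $\Omega\subset\mathbb{R}^n_x\times\mathbb{R}_t$ be a bounded open set, let $X=X(\Omega)$ be the space defined in the context, let $(v,u,q)\in X$ satisfy $|v(x,t)|=1$ for almost every $(x,t)\in\Omega$, and set $p:=q-\frac1n|v|^2$. Then there exist three sequences $\{v_k\},\{f_k\}\subset C^\infty_c(\mathbb{R}^n_x\times\mathbb{R}_t;\mathbb{R}^n)$ and $\{p_k\}\subset C^\infty_c(\mathbb{R}^n_x\times\mathbb{R}_t)$ solving $$\partial_t v_k+\operatorname{div}(v_k\otimes v_k)+\nabla p_k=f_k,\qquad \operatorname{div}v_k=0$$ for every $k$, such that \begin{itemize} \item $f_k$ converges to $0$ in $H^{-1}(\mathbb{R}^n_x\times\mathbb{R}_t)$; \item $\|v_k\|_\infty+\|p_k\|_\infty$ is uniformly bounded in $k$; \item $(v_k,p_k)\to(v,p)$ in $L^r(\mathbb{R}^n_x\times\mathbb{R}_t)$ for every $r<\infty$ ($r\ge1$). \end{itemize}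
   Context: All operators $\operatorname{div}$, $\nabla$ are in the space variable $x$ only. $\mathcal{S}^n_0$ denotes the space of symmetric trace-free real $n\times n$ matrices, $I_n$ the identity matrix. Let $$K=\Big\{(v,u)\in\mathbb{R}^n\times\mathcal{S}^n_0:\ u=v\otimes v-\tfrac1n|v|^2I_n,\ |v|=1\Big\},\qquad \mathcal{U}=\operatorname{int}\big(K^{co}\times[-1,1]\big),$$ where $K^{co}$ is the convex hull of $K$ and $\operatorname{int}$ is the topological interior in $\mathbb{R}^n\times\mathcal{S}^n_0\times\mathbb{R}$. For a bounded open $\Omega\subset\mathbb{R}^n_x\times\mathbb{R}_t$ let $X_0$ be the set of all $(v,u,q)\in C^\infty(\mathbb{R}^n_x\times\mathbb{R}_t;\mathbb{R}^n\times\mathcal{S}^n_0\times\mathbb{R})$ such that (i) $\operatorname{supp}(v,u,q)\subset\Omega$; (ii) $\partial_tv+\operatorname{div}u+\nabla q=0$ and $\operatorname{div}v=0$ in $\mathbb{R}^n_x\times\mathbb{R}_t$ (with $(\operatorname{div}u)_i=\sum_j\partial_{x_j}u_{ij}$); (iii) $(v,u,q)(x,t)\in\mathcal{U}$ for all $(x,t)$. $X$ is the closure of $X_0$ in the $L^\infty$ weak* topology. The pairs $(v,p)$ obtained from such $(v,u,q)\in X$ are solutions of the Euler equations with zero force. They are the solutions whose approximability is asserted here; the choice $\Omega=B_r(0)\times\,]-1,1[$, with $B_r(0)\subset\mathbb{R}^n$ the ball of volume $1$, gives solutions with $\int|v(x,t)|^2dx=1$ for a.e. $t\in\,]-1,1[$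 and $v=0$ for $|t|>1$. *)

theory Defs
  imports "HOL-Analysis.Analysis"
begin

section \<open>Smooth functions\<close>

primrec Ck :: "nat \<Rightarrow> ('a::euclidean_space \<Rightarrow> 'b::real_normed_vector) \<Rightarrow> bool" where
  "Ck 0 f \<longleftrightarrow> continuous_on UNIV f"
| "Ck (Suc k) f \<longleftrightarrow>
     (\<forall>z. f differentiable (at z)) \<and> (\<forall>b. Ck k (\<lambda>z. frechet_derivative f (at z) b))"

definition smooth :: "('a::euclidean_space \<Rightarrow> 'b::real_normed_vector) \<Rightarrow> bool" where
  "smooth f \<longleftrightarrow> (\<forall>k. Ck k f)"

definition supp :: "('a::topological_space \<Rightarrow> 'b::zero) \<Rightarrow> 'a set" where
  "supp f = closure {z. f z \<noteq> 0}"

definition Cc_infinity :: "('a::euclidean_space \<Rightarrow> 'b::real_normed_vector) set" where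
  "Cc_infinity = {f. smooth f \<and> compact (supp f)}"


section \<open>Differential operators on space-time\<close>

type_synonym 'n spacetime = "(real^'n) \<times> real"

definition dt :: "('n::finite spacetime \<Rightarrow> 'b::real_normed_vector) \<Rightarrow> 'n spacetime \<Rightarrow> 'b" where
  "dt f z = frechet_derivative f (at z) (0, 1)"

definition dx :: "'n::finite \<Rightarrow> ('n spacetime \<Rightarrow> 'b::real_normed_vector) \<Rightarrow> 'n spacetime \<Rightarrow> 'b" where
  "dx j f z = frechet_derivative f (at z) (axis j 1, 0)"

definition grad_x :: "('n::finite spacetime \<Rightarrow> real) \<Rightarrow> 'n spacetime \<Rightarrow> real^'n" where
  "grad_x q z = (\<chi> i. dx i q z)"

definition div_x :: "('n::finite spacetime \<Rightarrow> real^'n) \<Rightarrow> 'n spacetime \<Rightarrow> real" where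
  "div_x v z = (\<Sum>j\<in>UNIV. dx j (\<lambda>y. v y $ j) z)"

definition matdiv_x :: "('n::finite spacetime \<Rightarrow> real^'n^'n) \<Rightarrow> 'n spacetime \<Rightarrow> real^'n" where
  "matdiv_x u z = (\<chi> i. \<Sum>j\<in>UNIV. dx j (\<lambda>y. u y $ i $ j) z)"

definition outer :: "real^'n \<Rightarrow> real^'n \<Rightarrow> real^'n^'n" where
  "outer a b = (\<chi> i j. a $ i * b $ j)"


section \<open>The state space and the sets \<open>K\<close> and \<open>\<U>\<close>\<close>

type_synonym 'n state = "(real^'n) \<times> (real^'n^'n) \<times> real"

definition sym0 :: "(real^'n::finite^'n) set" where
  "sym0 = {A. transpose A = A \<and> trace A = 0}"

definition state_space :: "'n::finite state set" where
  "state_space = UNIV \<times> sym0 \<times> UNIV"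

definition K :: "((real^'n::finite) \<times> (real^'n^'n)) set" where
  "K = {(v, u). u \<in> sym0 \<and> norm v = 1 \<and>
                u = outer v v - ((norm v)\<^sup>2 / real CARD('n)) *\<^sub>R mat 1}"

text \<open>The interior is the one relative to \<^const>\<open>state_space\<close>, a proper subspace of the ambient
  type in which every subset of \<^const>\<open>state_space\<close> has empty interior.\<close>

definition U :: "'n::finite state set" where
  "U = (top_of_set state_space) interior_of
         {(v, u, q). (v, u) \<in> convex hull K \<and> q \<in> {-1..1}}"


section \<open>The spaces \<open>X\<^sub>0\<close> and \<open>X\<close>\<close>

definition Linfty :: "'b::euclidean_space set \<Rightarrow> ('a::euclidean_space \<Rightarrow> 'b) set" where
  "Linfty S = {f. f \<in> borel_measurable lebesgue \<and> (AE z in lebesgue. f z \<in> S) \<and>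
                  (\<exists>C. AE z in lebesgue. norm (f z) \<le> C)}"

text \<open>The weak* topology of \<open>L\<^sup>\<infinity>\<close> as the dual of \<open>L\<^sup>1\<close>, on functions rather than on classes of
  functions modulo null sets (equivalent functions are topologically indistinguishable). When \<open>S\<close>
  is a subspace, only the component of \<open>\<phi>\<close> in \<open>S\<close> matters, so \<open>\<phi>\<close> may range over all integrable
  functions.\<close>

definition Linfty_weak_star :: "'b::euclidean_space set \<Rightarrow> ('a::euclidean_space \<Rightarrow> 'b) topology" where
  "Linfty_weak_star S = topology_generated_by
     {{f \<in> Linfty S. (LINT z|lebesgue. f z \<bullet> \<phi> z) \<in> V} | \<phi> V.
        integrable lebesgue \<phi> \<and> open V}"

definition X0 :: "'n::finite spacetime set \<Rightarrow> ('n spacetime \<Rightarrow> 'n state) set" where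
  "X0 \<Omega> = {(\<lambda>z. (v z, u z, q z)) | v u q.
      smooth (\<lambda>z. (v z, u z, q z)) \<and>
      supp (\<lambda>z. (v z, u z, q z)) \<subseteq> \<Omega> \<and>
      (\<forall>z. dt v z + matdiv_x u z + grad_x q z = 0 \<and> div_x v z = 0) \<and>
      (\<forall>z. (v z, u z, q z) \<in> U)}"

definition X :: "'n::finite spacetime set \<Rightarrow> ('n spacetime \<Rightarrow> 'n state) set" where
  "X \<Omega> = Linfty_weak_star state_space closure_of X0 \<Omega>"


section \<open>Function-space norms and convergence\<close>

definition L2 :: "('a::euclidean_space \<Rightarrow> 'b::euclidean_space) set" where
  "L2 = {f. f \<in> borel_measurable lebesgue \<and> integrable lebesgue (\<lambda>z. (norm (f z))\<^sup>2)}"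

definition has_weak_deriv ::
  "('a::euclidean_space \<Rightarrow> 'b::euclidean_space) \<Rightarrow> 'a \<Rightarrow> ('a \<Rightarrow> 'b) \<Rightarrow> bool" where
  "has_weak_deriv f b g \<longleftrightarrow> (\<forall>\<psi>::'a \<Rightarrow> real. \<psi> \<in> Cc_infinity \<longrightarrow>
     (LINT z|lebesgue. frechet_derivative \<psi> (at z) b *\<^sub>R f z) = - (LINT z|lebesgue. \<psi> z *\<^sub>R g z))"

definition H1_unit_ball :: "('a::euclidean_space \<Rightarrow> 'b::euclidean_space) set" where
  "H1_unit_ball = {f \<in> L2. \<exists>G. (\<forall>b\<in>Basis. G b \<in> L2 \<and> has_weak_deriv f b (G b)) \<and>
     (LINT z|lebesgue. (norm (f z))\<^sup>2) + (\<Sum>b\<in>Basis. LINT z|lebesgue. (norm (G b z))\<^sup>2) \<le> 1}"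

text \<open>The norm of \<open>f\<close> in the dual of \<open>H\<^sup>1\<close>, for functions \<open>f\<close> in \<^const>\<open>L2\<close>, acting by the
  \<open>L\<^sup>2\<close> pairing.\<close>

definition Hminus1_norm :: "('a::euclidean_space \<Rightarrow> 'b::euclidean_space) \<Rightarrow> ennreal" where
  "Hminus1_norm f = (SUP \<phi>\<in>H1_unit_ball. ennreal \<bar>LINT z|lebesgue. f z \<bullet> \<phi> z\<bar>)"

text \<open>For continuous functions the supremum is the essential supremum.\<close>

definition sup_norm :: "('a \<Rightarrow> 'b::real_normed_vector) \<Rightarrow> ennreal" where
  "sup_norm f = (SUP z. ennreal (norm (f z)))"

definition tendsto_Lr ::
  "real \<Rightarrow> (nat \<Rightarrow> 'a::euclidean_space \<Rightarrow> 'b::euclidean_space) \<Rightarrow> ('a \<Rightarrow> 'b) \<Rightarrow> bool" where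
  "tendsto_Lr r F f \<longleftrightarrow>
     (\<lambda>k. \<integral>\<^sup>+z. ennreal (norm (F k z - f z) powr r) \<partial>lebesgue) \<longlonglongrightarrow> 0"

end

theory Submission
  imports Defs
begin

text \<open>The set \<open>X\<^sub>0\<close> is convex, so weak* approximation in \<open>X\<^sub>0\<close> can be improved to strong \<open>L\<^sup>2\<close>
  approximation (Mazur), and after passing to a subsequence there are \<open>(v\<^sub>k, u\<^sub>k, q\<^sub>k)\<close> in \<open>X\<^sub>0\<close>
  converging to \<open>(v, u, q)\<close> almost everywhere. All of these are supported in \<open>\<Omega>\<close> and uniformly
  bounded. With \<open>p\<^sub>k = q\<^sub>k - |v\<^sub>k|\<^sup>2 / n\<close> the error term is the divergence of
  \<open>A\<^sub>k = v\<^sub>k \<otimes> v\<^sub>k - (|v\<^sub>k|\<^sup>2 / n) I - u\<^sub>k\<close>. Since \<open>(v\<^sub>k, u\<^sub>k)\<close> lies in the convex hull of \<open>K\<close>,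
  \<open>|A\<^sub>k| \<le> L (1 - |v\<^sub>k|\<^sup>2)\<close> for a constant \<open>L\<close>, and \<open>|v| = 1\<close> on \<open>\<Omega>\<close> makes this tend to \<open>0\<close> almost
  everywhere. Dominated convergence gives \<open>A\<^sub>k \<rightarrow> 0\<close> in \<open>L\<^sup>2\<close>, hence \<open>div A\<^sub>k \<rightarrow> 0\<close> in \<open>H\<^sup>-\<^sup>1\<close>, as well
  as the \<open>L\<^sup>r\<close> convergence of \<open>(v\<^sub>k, p\<^sub>k)\<close>.\<close>

section \<open>Calculus of smooth functions\<close>

lemma Ck_Suc_imp_Ck: "Ck (Suc k) f \<Longrightarrow> Ck k f"
  by (induction k arbitrary: f)
     (auto intro!: differentiable_imp_continuous_on simp: differentiable_on_def
           intro: differentiable_at_withinI)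

lemma Ck_const: "Ck k (\<lambda>z. c)"
  by (induction k arbitrary: c) auto

lemma frechet_derivative_add:
  assumes "f differentiable (at z)" "g differentiable (at z)"
  shows "frechet_derivative (\<lambda>z. f z + g z) (at z) =
    (\<lambda>b. frechet_derivative f (at z) b + frechet_derivative g (at z) b)"
  using assms has_derivative_add[of f _ "at z" g]
  by (metis frechet_derivative_at frechet_derivative_works)

lemma frechet_derivative_diff:
  assumes "f differentiable (at z)" "g differentiable (at z)"
  shows "frechet_derivative (\<lambda>z. f z - g z) (at z) =
    (\<lambda>b. frechet_derivative f (at z) b - frechet_derivative g (at z) b)"
  using assms has_derivative_diff[of f _ "at z" g]
  by (metis frechet_derivative_at frechet_derivative_works)

lemma Ck_add: "Ck k f \<Longrightarrow> Ck k g \<Longrightarrow> Ck k (\<lambda>z. f z + g z)"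
proof (induction k arbitrary: f g)
  case 0
  then show ?case by (auto intro: continuous_intros)
next
  case (Suc k)
  have "frechet_derivative (\<lambda>z. f z + g z) (at z) b =
        frechet_derivative f (at z) b + frechet_derivative g (at z) b" for z b
    using Suc.prems by (simp add: frechet_derivative_add)
  with Suc show ?case by auto
qed

lemma frechet_derivative_bounded_linear:
  assumes "bounded_linear L" "f differentiable (at z)"
  shows "frechet_derivative (\<lambda>z. L (f z)) (at z) = (\<lambda>b. L (frechet_derivative f (at z) b))"
  using bounded_linear.has_derivative[OF assms(1)] assms(2)
  by (intro frechet_derivative_at[symmetric]) (simp add: frechet_derivative_works)

lemma differentiable_bounded_linear:
  assumes "bounded_linear L" "f differentiable (at z)"
  shows "(\<lambda>z. L (f z)) differentiable (at z)"
  using assms bounded_linear.has_derivative[OF assms(1)] unfolding differentiable_def by blast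

lemma Ck_bounded_linear:
  assumes "bounded_linear L"
  shows "Ck k f \<Longrightarrow> Ck k (\<lambda>z. L (f z))"
proof (induction k arbitrary: f)
  case 0
  then show ?case by (auto intro: bounded_linear.continuous_on[OF assms])
next
  case (Suc k)
  then show ?case
    by (auto simp: frechet_derivative_bounded_linear[OF assms]
             intro: differentiable_bounded_linear[OF assms])
qed

text \<open>By the product rule a directional derivative is a sum of two terms of the same bilinear
  form, each with one factor left undifferentiated. \<open>Ck_Suc_imp_Ck\<close> lowers that factor
  to order \<open>k\<close>, so the induction hypothesis applies to both terms.\<close>

lemma Ck_bounded_bilinear:
  assumes "bounded_bilinear B"
  shows "Ck k f \<Longrightarrow> Ck k g \<Longrightarrow> Ck k (\<lambda>z. B (f z) (g z))"
proof (induction k arbitrary: f g)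
  case 0
  then show ?case by (auto intro: bounded_bilinear.continuous_on[OF assms])
next
  case (Suc k)
  have "((\<lambda>z. B (f z) (g z)) has_derivative
     (\<lambda>b. B (f z) (frechet_derivative g (at z) b) + B (frechet_derivative f (at z) b) (g z))) (at z)" for z
    using Suc.prems by (intro bounded_bilinear.FDERIV[OF assms]) (auto simp: frechet_derivative_works[symmetric])
  note D = this
  have "frechet_derivative (\<lambda>z. B (f z) (g z)) (at z) =
     (\<lambda>b. B (f z) (frechet_derivative g (at z) b) + B (frechet_derivative f (at z) b) (g z))" for z
    by (rule frechet_derivative_at[OF D, symmetric])
  then show ?case
    using Suc.prems Ck_Suc_imp_Ck[OF Suc.prems(1)] Ck_Suc_imp_Ck[OF Suc.prems(2)] D
    by (auto intro!: Ck_add Suc.IH intro: differentiableI)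
qed

lemma smooth_differentiable: "smooth f \<Longrightarrow> f differentiable (at z)"
  unfolding smooth_def by (metis Ck.simps(2))

lemma smooth_continuous_on: "smooth f \<Longrightarrow> continuous_on UNIV f"
  unfolding smooth_def by (metis Ck.simps(1))

lemma smooth_frechet_derivative: "smooth f \<Longrightarrow> smooth (\<lambda>z. frechet_derivative f (at z) b)"
  unfolding smooth_def by (metis Ck.simps(2))

lemma smooth_const: "smooth (\<lambda>z. c)"
  by (simp add: smooth_def Ck_const)

lemma smooth_add: "smooth f \<Longrightarrow> smooth g \<Longrightarrow> smooth (\<lambda>z. f z + g z)"
  by (simp add: smooth_def Ck_add)

lemma smooth_bounded_linear: "bounded_linear L \<Longrightarrow> smooth f \<Longrightarrow> smooth (\<lambda>z. L (f z))"
  by (simp add: smooth_def Ck_bounded_linear)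

lemma smooth_bounded_bilinear:
  "bounded_bilinear B \<Longrightarrow> smooth f \<Longrightarrow> smooth g \<Longrightarrow> smooth (\<lambda>z. B (f z) (g z))"
  by (simp add: smooth_def Ck_bounded_bilinear)

lemma smooth_scaleR: "smooth f \<Longrightarrow> smooth (\<lambda>z. c *\<^sub>R f z)"
  by (rule smooth_bounded_linear[OF bounded_linear_scaleR_right])

lemma smooth_diff: "smooth f \<Longrightarrow> smooth g \<Longrightarrow> smooth (\<lambda>z. f z - g z)"
  using smooth_add[of f "\<lambda>z. (-1) *\<^sub>R g z"] smooth_scaleR[of g "-1"] by simp

lemma smooth_mult:
  fixes f g :: "'a::euclidean_space \<Rightarrow> real"
  shows "smooth f \<Longrightarrow> smooth g \<Longrightarrow> smooth (\<lambda>z. f z * g z)"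
  by (rule smooth_bounded_bilinear[OF bounded_bilinear_mult])

lemma smooth_sum: "(\<And>i. i \<in> I \<Longrightarrow> smooth (f i)) \<Longrightarrow> smooth (\<lambda>z. \<Sum>i\<in>I. f i z)"
  by (induction I rule: infinite_finite_induct) (auto intro: smooth_const smooth_add)

lemma smooth_vec_nth: "smooth f \<Longrightarrow> smooth (\<lambda>z. f z $ i)"
  by (rule smooth_bounded_linear[OF bounded_linear_vec_nth])

lemma smooth_vec_lambda:
  fixes f :: "'n::finite \<Rightarrow> 'a::euclidean_space \<Rightarrow> real"
  assumes "\<And>i. smooth (f i)"
  shows "smooth (\<lambda>z. \<chi> i. f i z)"
proof -
  have "(\<lambda>z. \<chi> i. f i z) = (\<lambda>z. \<Sum>i\<in>UNIV. f i z *\<^sub>R axis i 1)"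
    by (auto simp: vec_eq_iff axis_def if_distrib cong: if_cong)
  moreover have "smooth (\<lambda>z. \<Sum>i\<in>UNIV. f i z *\<^sub>R (axis i 1 :: real^'n))"
    by (intro smooth_sum smooth_bounded_linear[OF bounded_linear_scaleR_left] assms)
  ultimately show ?thesis by simp
qed

lemma frechet_derivative_eq_0_outside_supp:
  assumes "z \<notin> supp f"
  shows "frechet_derivative f (at z) b = 0"
proof -
  have "(f has_derivative (\<lambda>_. 0)) (at z)"
  proof (rule has_derivative_transform_within_open[of "\<lambda>_. 0"])
    show "open (- supp f)" unfolding supp_def by (rule open_Compl) simp
    show "0 = f y" if "y \<in> - supp f" for y
      using that closure_subset[of "{z. f z \<noteq> 0}"] by (auto simp: supp_def)
  qed (use assms in auto)
  from frechet_derivative_at[OF this] show ?thesis by metis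
qed

lemma Cc_infinityI:
  assumes "smooth f" "compact S" "\<And>z. z \<notin> S \<Longrightarrow> f z = 0"
  shows "f \<in> Cc_infinity"
proof -
  have "supp f \<subseteq> S"
    unfolding supp_def using assms by (intro closure_minimal) (auto intro: compact_imp_closed)
  then have "compact (supp f)"
    using assms(2) by (metis closed_closure compact_Int_closed inf.absorb_iff2 supp_def)
  with assms(1) show ?thesis by (simp add: Cc_infinity_def)
qed

section \<open>The convex hull of \<open>K\<close> and the set \<open>\<U>\<close>\<close>

text \<open>The norm on matrices is the Frobenius norm, so the double sum of squared entries
  factorises.\<close>

lemma norm_outer: "norm (outer a a) = (norm (a::real^'n::finite))\<^sup>2"
proof -
  have "(norm (outer a a))\<^sup>2 = ((norm a)\<^sup>2)\<^sup>2"
    by (simp add: power2_norm_eq_inner inner_vec_def outer_def)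
       (simp add: power2_eq_square sum_product mult_ac)
  then show ?thesis by (rule power2_eq_imp_eq) auto
qed

text \<open>For \<open>(v, u)\<close> in the convex hull of \<^const>\<open>K\<close>, this is the covariance matrix of a probability
  measure on the unit sphere with barycentre \<open>v\<close>, so its norm is at most its trace \<open>1 - |v|\<^sup>2\<close>.\<close>

definition defect :: "real^'n::finite \<Rightarrow> real^'n^'n \<Rightarrow> real^'n^'n" where
  "defect v u = u + (1 / real CARD('n)) *\<^sub>R mat 1 - outer v v"

text \<open>Law of total covariance: mixing two pairs adds
  \<open>(s * t) *\<^sub>R outer (v1 - v2) (v1 - v2)\<close> to the mixture of their defects. The
  norm of this extra term is exactly the amount by which \<open>1 - |v|^2\<close> at the mixture
  exceeds the mixture of its two values, so the inequality survives.\<close>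

lemma convex_defect:
  "convex {(v, u :: real^'n::finite^'n). norm (defect v u) \<le> 1 - (norm v)\<^sup>2}"
proof (rule convexI, clarsimp)
  fix v1 v2 :: "real^'n" and u1 u2 :: "real^'n^'n" and s t :: real
  assume 1: "norm (defect v1 u1) \<le> 1 - (norm v1)\<^sup>2" and 2: "norm (defect v2 u2) \<le> 1 - (norm v2)\<^sup>2"
    and st: "0 \<le> s" "0 \<le> t" "s + t = 1"
  have t: "t = 1 - s" using st by simp
  have "defect (s *\<^sub>R v1 + t *\<^sub>R v2) (s *\<^sub>R u1 + t *\<^sub>R u2) =
        s *\<^sub>R defect v1 u1 + t *\<^sub>R defect v2 u2 + (s * t) *\<^sub>R outer (v1 - v2) (v1 - v2)"
    unfolding t by (simp add: vec_eq_iff defect_def outer_def algebra_simps flip: add_divide_distrib)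
  also have "norm \<dots> \<le> s * norm (defect v1 u1) + t * norm (defect v2 u2) + (s * t) * (norm (v1 - v2))\<^sup>2"
    using st by (intro norm_triangle_le add_mono) (auto simp: norm_outer)
  also have "\<dots> \<le> s * (1 - (norm v1)\<^sup>2) + t * (1 - (norm v2)\<^sup>2) + (s * t) * (norm (v1 - v2))\<^sup>2"
    using st 1 2 by (intro add_mono mult_left_mono) auto
  also have "\<dots> = 1 - (norm (s *\<^sub>R v1 + t *\<^sub>R v2))\<^sup>2"
    unfolding t by (simp add: power2_norm_eq_inner inner_commute algebra_simps)
  finally show "norm (defect (s *\<^sub>R v1 + t *\<^sub>R v2) (s *\<^sub>R u1 + t *\<^sub>R u2))
    \<le> 1 - (norm (s *\<^sub>R v1 + t *\<^sub>R v2))\<^sup>2" .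
qed

text \<open>On \<open>K\<close> both sides are zero, and the set cut out by the inequality is
  convex, so it contains the hull.\<close>

lemma norm_defect_convex_hull_K:
  assumes "(v, u) \<in> convex hull K"
  shows "norm (defect v u) \<le> 1 - (norm v)\<^sup>2"
proof -
  have "convex hull K \<subseteq> {(v, u :: real^'n::finite^'n). norm (defect v u) \<le> 1 - (norm v)\<^sup>2}"
    by (rule hull_minimal) (simp_all add: convex_defect, auto simp: K_def defect_def)
  with assms show ?thesis by auto
qed

text \<open>A point \<open>?p + h\<close> near a combination \<open>?p\<close> of \<open>x\<close>
  and \<open>y\<close> is the same combination of \<open>x + h\<close> and \<open>y + h\<close>. For
  small \<open>h\<close> in the subspace \<open>S\<close> both of these stay in the relative
  neighbourhoods of \<open>x\<close> and \<open>y\<close> inside \<open>C\<close>.\<close>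

lemma convex_interior_of_subspace:
  fixes S C :: "'a::real_normed_vector set"
  assumes "subspace S" "convex C"
  shows "convex (top_of_set S interior_of C)"
proof (rule convexI)
  have mem: "x \<in> top_of_set S interior_of C \<longleftrightarrow> x \<in> S \<and> (\<exists>e>0. ball x e \<inter> S \<subseteq> C)" for x
    unfolding interior_of_def openin_contains_ball
    apply safe
      apply blast
     apply (metis inf_commute order_trans)
    subgoal for e
      apply (rule exI[of _ "ball x e \<inter> S"])
      using openin_contains_ball[of S "ball x e \<inter> S"] openin_open_Int[OF open_ball, of S x e] 
      by (auto simp: Int_commute)
    done
  fix x y :: 'a and s t :: real
  assume x: "x \<in> top_of_set S interior_of C" and y: "y \<in> top_of_set S interior_of C"
    and st: "0 \<le> s" "0 \<le> t" "s + t = 1"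
  obtain d e where d: "d > 0" "ball x d \<inter> S \<subseteq> C" and e: "e > 0" "ball y e \<inter> S \<subseteq> C"
    and xy: "x \<in> S" "y \<in> S" using x y by (auto simp: mem)
  let ?p = "s *\<^sub>R x + t *\<^sub>R y"
  have p: "?p \<in> S" using assms xy by (simp add: subspace_add subspace_scale)
  have "z \<in> C" if z: "z \<in> ball ?p (min d e)" "z \<in> S" for z
  proof -
    define h where "h = z - ?p"
    have "h \<in> S" "norm h < d" "norm h < e"
      using z p assms by (auto simp: h_def subspace_diff dist_norm norm_minus_commute)
    then have "x + h \<in> C" "y + h \<in> C"
      using d e xy assms(1) by (auto simp: subset_iff dist_norm subspace_add)
    then have "s *\<^sub>R (x + h) + t *\<^sub>R (y + h) \<in> C"
      using assms(2) st by (simp add: convexD)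
    moreover have "s *\<^sub>R (x + h) + t *\<^sub>R (y + h) = ?p + (s + t) *\<^sub>R h" by (simp add: algebra_simps)
    ultimately show ?thesis using st by (simp add: h_def)
  qed
  then show "?p \<in> top_of_set S interior_of C"
    using p d e by (auto simp: mem intro!: exI[of _ "min d e"])
qed

lemma subspace_state_space: "subspace (state_space :: 'n::finite state set)"
  unfolding subspace_def state_space_def sym0_def
  by (auto simp: zero_prod_def transpose_def vec_eq_iff trace_def sum.distrib
      scaleR_sum_right[symmetric] sum_distrib_left[symmetric])

lemma convex_U: "convex (U :: 'n::finite state set)"
proof -
  \<comment> \<open>Regrouping the triple exhibits the set as a linear image of a product of convex
    sets.\<close>
  have "{(v, u, q :: real). (v, u :: real^'n^'n) \<in> convex hull K \<and> q \<in> {-1..1}} =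
     (\<lambda>((v, u), q). (v, u, q)) ` ((convex hull K) \<times> {-1..1})" by force
  moreover have "convex \<dots>"
    by (intro convex_linear_image convex_Times convex_convex_hull)
       (auto intro!: linearI simp: split_beta)
  ultimately show ?thesis unfolding U_def
    by (intro convex_interior_of_subspace subspace_state_space) simp
qed

section \<open>Bounded functions and Mazur's lemma\<close>

text \<open>One inequality encodes both essential boundedness and vanishing almost everywhere off
  \<open>\<Omega>\<close>. When \<open>\<Omega>\<close> has finite measure such functions are
  integrable, and the class is closed under linear combinations and inner products, so all integrals
  in Mazur's lemma exist.\<close>

definition bounded_on :: "'a::euclidean_space set \<Rightarrow> ('a \<Rightarrow> 'b::euclidean_space) set" where
  "bounded_on \<Omega> = {f \<in> borel_measurable lebesgue.
     \<exists>C. AE z in lebesgue. norm (f z) \<le> C * indicator \<Omega> z}"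

lemma bounded_onI:
  "f \<in> borel_measurable lebesgue \<Longrightarrow> AE z in lebesgue. norm (f z) \<le> C * indicator \<Omega> z
    \<Longrightarrow> f \<in> bounded_on \<Omega>"
  by (auto simp: bounded_on_def)

lemma bounded_on_integrable:
  assumes "\<Omega> \<in> lmeasurable" "f \<in> bounded_on \<Omega>"
  shows "integrable lebesgue f"
proof -
  obtain C where C: "AE z in lebesgue. norm (f z) \<le> C * indicator \<Omega> z"
    and f: "f \<in> borel_measurable lebesgue" using assms by (auto simp: bounded_on_def)
  have "integrable lebesgue (\<lambda>z. C * indicator \<Omega> z :: real)"
    using assms(1) by (intro integrable_mult_right) (auto simp: fmeasurable_def intro: integrable_real_indicator)
  then show ?thesis
    by (rule Bochner_Integration.integrable_bound[OF _ f]) (use C in \<open>auto elim!: AE_mp\<close>)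
qed

lemma bounded_on_add:
  assumes "f \<in> bounded_on \<Omega>" "g \<in> bounded_on \<Omega>"
  shows "(\<lambda>z. f z + g z) \<in> bounded_on \<Omega>"
proof -
  obtain C D where C: "AE z in lebesgue. norm (f z) \<le> C * indicator \<Omega> z"
    and D: "AE z in lebesgue. norm (g z) \<le> D * indicator \<Omega> z"
    and [measurable]: "f \<in> borel_measurable lebesgue" "g \<in> borel_measurable lebesgue"
    using assms by (auto simp: bounded_on_def)
  from C D have "AE z in lebesgue. norm (f z + g z) \<le> (C + D) * indicator \<Omega> z"
    by eventually_elim (metis add_mono distrib_right norm_triangle_le)
  then show ?thesis by (intro bounded_onI) auto
qed

lemma bounded_on_scaleR:
  assumes "f \<in> bounded_on \<Omega>"
  shows "(\<lambda>z. c *\<^sub>R f z) \<in> bounded_on \<Omega>"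
proof -
  obtain C where C: "AE z in lebesgue. norm (f z) \<le> C * indicator \<Omega> z"
    and [measurable]: "f \<in> borel_measurable lebesgue"
    using assms by (auto simp: bounded_on_def)
  from C have "AE z in lebesgue. norm (c *\<^sub>R f z) \<le> (\<bar>c\<bar> * C) * indicator \<Omega> z"
    by eventually_elim (simp add: mult.assoc mult_left_mono)
  then show ?thesis by (intro bounded_onI) auto
qed

lemma bounded_on_diff:
  assumes "f \<in> bounded_on \<Omega>" "g \<in> bounded_on \<Omega>"
  shows "(\<lambda>z. f z - g z) \<in> bounded_on \<Omega>"
  using bounded_on_add[OF assms(1) bounded_on_scaleR[OF assms(2), of "-1"]] by simp

lemma bounded_on_inner:
  assumes "f \<in> bounded_on \<Omega>" "g \<in> bounded_on \<Omega>"
  shows "(\<lambda>z. f z \<bullet> g z) \<in> bounded_on \<Omega>"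
proof -
  obtain C D where C: "AE z in lebesgue. norm (f z) \<le> C * indicator \<Omega> z"
    and D: "AE z in lebesgue. norm (g z) \<le> D * indicator \<Omega> z"
    and [measurable]: "f \<in> borel_measurable lebesgue" "g \<in> borel_measurable lebesgue"
    using assms by (auto simp: bounded_on_def)
  from C D have "AE z in lebesgue. norm (f z \<bullet> g z) \<le> (C * D) * indicator \<Omega> z"
  proof eventually_elim
    case (elim z)
    have "norm (f z \<bullet> g z) \<le> norm (f z) * norm (g z)"
      by (simp add: Cauchy_Schwarz_ineq2)
    also have "\<dots> \<le> (C * indicator \<Omega> z) * (D * indicator \<Omega> z)"
      using elim by (intro mult_mono) (auto intro: order_trans[OF norm_ge_zero])
    also have "\<dots> = (C * D) * indicator \<Omega> z" by (simp add: indicator_def)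
    finally show ?case .
  qed
  then show ?thesis by (intro bounded_onI) auto
qed

text \<open>Mazur's lemma, by comparing a near-minimiser \<open>f\<close> of the distance to \<open>w\<close> with the convex
  combination \<open>(1 - \<eta>) f + \<eta> g\<close>, where \<open>g\<close> is weakly close to \<open>w\<close>.\<close>

lemma L2_approx_of_weak_closure:
  fixes F :: "('a::euclidean_space \<Rightarrow> 'b::euclidean_space) set"
  assumes \<Omega>: "\<Omega> \<in> lmeasurable"
    and F: "\<And>f. f \<in> F \<Longrightarrow> f \<in> borel_measurable lebesgue"
           "\<And>f z. f \<in> F \<Longrightarrow> norm (f z) \<le> M * indicator \<Omega> z"
    and conv: "\<And>f g t. f \<in> F \<Longrightarrow> g \<in> F \<Longrightarrow> 0 \<le> t \<Longrightarrow> t \<le> 1 \<Longrightarrow> (\<lambda>z. (1 - t) *\<^sub>R f z + t *\<^sub>R g z) \<in> F"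
    and w: "w \<in> bounded_on \<Omega>"
    and weak: "\<And>\<phi> e. integrable lebesgue \<phi> \<Longrightarrow> e > 0 \<Longrightarrow>
        \<exists>g\<in>F. \<bar>(LINT z|lebesgue. g z \<bullet> \<phi> z) - (LINT z|lebesgue. w z \<bullet> \<phi> z)\<bar> < e"
    and "e > 0"
  shows "\<exists>f\<in>F. (LINT z|lebesgue. (norm (f z - w z))\<^sup>2) < e"
proof -
  define I where "I f = (LINT z|lebesgue. (norm (f z - w z))\<^sup>2)" for f
  \<comment> \<open>\<open>D\<close> bounds the squared L2 distance of any two members of
    \<open>F\<close>: they differ by at most \<open>2 * M\<close> on \<open>\<Omega>\<close> and
    agree outside.\<close>
  define D where "D = (2 * M)\<^sup>2 * measure lebesgue \<Omega>"
  have D0: "D \<ge> 0" by (simp add: D_def)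
  have FB: "f \<in> bounded_on \<Omega>" if "f \<in> F" for f
    using F that by (intro bounded_onI) auto
  have int: "integrable lebesgue (\<lambda>z. f z \<bullet> g z)" if "f \<in> bounded_on \<Omega>" "g \<in> bounded_on \<Omega>"
    for f g :: "'a \<Rightarrow> 'b"
    using bounded_on_integrable[OF \<Omega> bounded_on_inner[OF that]] .
  have I0: "I f \<ge> 0" for f by (simp add: I_def)
  have "F \<noteq> {}" using weak[of "\<lambda>_. 0" 1] by auto
  define d where "d = (INF f\<in>F. I f)"
  have bdd: "bdd_below (I ` F)" using I0 by (auto intro!: bdd_belowI[of _ 0])
  \<comment> \<open>The denominator is the factor in the final estimate
    \<open>2 * I f < \<eta> * (2 + (1 + D))\<close>; the cap \<open>1\<close> makes
    \<open>\<eta>\<close> a legitimate weight of a convex combination.\<close>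
  define \<eta> where "\<eta> = min 1 (e / (2 + (1 + D)))"
  have \<eta>: "\<eta> > 0" "\<eta> \<le> 1" "\<eta> * (2 + (1 + D)) \<le> e"
    using \<open>e > 0\<close> D0 by (auto simp: \<eta>_def min_def le_divide_eq)
  \<comment> \<open>A near-minimiser suffices; its gap \<open>\<eta>^2\<close> is still of order
    \<open>\<eta>\<close> after the later division by \<open>\<eta>\<close>.\<close>
  have "d < d + \<eta>\<^sup>2" using \<eta> by simp
  then obtain f where f: "f \<in> F" "I f < d + \<eta>\<^sup>2"
    unfolding d_def using cINF_less_iff[OF \<open>F \<noteq> {}\<close> bdd] by blast
  define \<phi> where "\<phi> z = w z - f z" for z
  have \<phi>B: "\<phi> \<in> bounded_on \<Omega>" unfolding \<phi>_def by (intro bounded_on_diff w FB f)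
  obtain g where g: "g \<in> F"
    and gw: "\<bar>(LINT z|lebesgue. g z \<bullet> \<phi> z) - (LINT z|lebesgue. w z \<bullet> \<phi> z)\<bar> < \<eta>"
    using weak[OF bounded_on_integrable[OF \<Omega> \<phi>B] \<eta>(1)] by blast
  define \<psi> where "\<psi> z = g z - f z" for z
  have \<psi>B: "\<psi> \<in> bounded_on \<Omega>" unfolding \<psi>_def by (intro bounded_on_diff FB f g)
  define P where "P = (LINT z|lebesgue. \<phi> z \<bullet> \<psi> z)"
  define Q where "Q = (LINT z|lebesgue. \<psi> z \<bullet> \<psi> z)"
  have "norm (\<psi> z) \<le> 2 * M * indicator \<Omega> z" for z
    using F(2)[OF f(1), of z] F(2)[OF g, of z] norm_triangle_ineq4[of "g z" "f z"]
    by (simp add: \<psi>_def)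
  then have "(norm (\<psi> z))\<^sup>2 \<le> (2 * M * indicator \<Omega> z)\<^sup>2" for z
    by (intro power_mono) auto
  moreover have "(indicator \<Omega> z :: real)\<^sup>2 = indicator \<Omega> z" for z
    by (simp add: indicator_def)
  ultimately have le: "\<psi> z \<bullet> \<psi> z \<le> (2 * M)\<^sup>2 * indicator \<Omega> z" for z
    by (simp add: power2_norm_eq_inner power_mult_distrib)
  have "Q \<le> (LINT z|lebesgue. (2 * M)\<^sup>2 * indicator \<Omega> z)"
    unfolding Q_def
    using \<Omega> by (intro integral_mono int \<psi>B le integrable_mult_right integrable_real_indicator)
      (auto simp: fmeasurable_def)
  also have "\<dots> = D" using \<Omega> by (simp add: D_def)
  finally have "Q \<le> D" .
  have If: "I f = (LINT z|lebesgue. \<phi> z \<bullet> \<phi> z)"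
    by (simp add: I_def \<phi>_def power2_norm_eq_inner[symmetric] norm_minus_commute)
  let ?h = "\<lambda>z. (1 - \<eta>) *\<^sub>R f z + \<eta> *\<^sub>R g z"
  have "d \<le> I ?h" unfolding d_def
    using \<eta> f g by (intro cINF_lower[OF bdd] conv) auto
  also have "I ?h = (LINT z|lebesgue. \<phi> z \<bullet> \<phi> z - (2 * \<eta>) * (\<phi> z \<bullet> \<psi> z) + \<eta>\<^sup>2 * (\<psi> z \<bullet> \<psi> z))"
  proof -
    have "(norm (?h z - w z))\<^sup>2 = \<phi> z \<bullet> \<phi> z - (2 * \<eta>) * (\<phi> z \<bullet> \<psi> z) + \<eta>\<^sup>2 * (\<psi> z \<bullet> \<psi> z)" for z
    proof -
      have "?h z - w z = \<eta> *\<^sub>R \<psi> z - \<phi> z" by (simp add: \<phi>_def \<psi>_def algebra_simps)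
      then have "(norm (?h z - w z))\<^sup>2 = (\<eta> *\<^sub>R \<psi> z - \<phi> z) \<bullet> (\<eta> *\<^sub>R \<psi> z - \<phi> z)"
        by (simp add: power2_norm_eq_inner)
      then show ?thesis
        by (simp add: inner_diff_left inner_diff_right inner_commute algebra_simps power2_eq_square)
    qed
    then show ?thesis by (simp add: I_def)
  qed
  also have "\<dots> = I f - (2 * \<eta>) * P + \<eta>\<^sup>2 * Q"
    by (simp add: If P_def Q_def int \<phi>B \<psi>B)
  \<comment> \<open>Combines \<open>d \<le> I ?h\<close> with \<open>I f < d + \<eta>^2\<close>:
    moving from \<open>f\<close> towards \<open>g\<close> cannot reduce the distance by much, which
    bounds \<open>P\<close> from above.\<close>
  finally have "2 * \<eta> * P \<le> \<eta>\<^sup>2 * (1 + Q)" using f by (simp add: algebra_simps)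
  then have "2 * P \<le> \<eta> * (1 + Q)" using \<eta> by (simp add: power2_eq_square)
  also have "\<dots> \<le> \<eta> * (1 + D)" using \<open>Q \<le> D\<close> \<eta> by simp
  finally have P: "2 * P \<le> \<eta> * (1 + D)" .
  \<comment> \<open>Since \<open>\<phi> = \<psi> - (g - w)\<close>, the squared distance is
    \<open>P\<close> up to the weak error of \<open>g\<close>, tested against the very
    \<open>\<phi>\<close> for which \<open>g\<close> was chosen.\<close>
  have "(\<lambda>z. \<phi> z \<bullet> \<phi> z) = (\<lambda>z. \<phi> z \<bullet> \<psi> z - (g z \<bullet> \<phi> z - w z \<bullet> \<phi> z))"
    by (auto simp: \<phi>_def \<psi>_def inner_diff_left inner_diff_right inner_commute)
  then have "I f = P - ((LINT z|lebesgue. g z \<bullet> \<phi> z) - (LINT z|lebesgue. w z \<bullet> \<phi> z))"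
    by (simp add: If P_def int \<phi>B \<psi>B FB g w)
  then have "2 * I f < 2 * \<eta> + \<eta> * (1 + D)" using P gw by linarith
  also have "\<dots> \<le> e" using \<eta>(3) by (simp add: algebra_simps)
  finally have "I f < e" using I0[of f] by linarith
  then show ?thesis using f by (auto simp: I_def)
qed

section \<open>Divergences in \<open>H\<^sup>-\<^sup>1\<close>\<close>

lemma continuous_imp_lebesgue_measurable:
  fixes f :: "'a::euclidean_space \<Rightarrow> 'b::euclidean_space"
  assumes "continuous_on UNIV f"
  shows "f \<in> borel_measurable lebesgue"
  using borel_measurable_continuous_onI[OF assms] by (auto intro: measurable_completion)

lemma continuous_imp_bounded_on:
  fixes f :: "'a::euclidean_space \<Rightarrow> 'b::euclidean_space"
  assumes "continuous_on UNIV f" "compact S" "\<And>z. z \<notin> S \<Longrightarrow> f z = 0"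
  shows "f \<in> bounded_on S"
proof -
  have "bounded (f ` S)"
    using assms by (meson compact_continuous_image compact_imp_bounded continuous_on_subset subset_UNIV)
  then obtain C where "\<And>z. z \<in> S \<Longrightarrow> norm (f z) \<le> C" by (auto simp: bounded_iff)
  then have "norm (f z) \<le> C * indicator S z" for z
    using assms(3)[of z] by (cases "z \<in> S") auto
  moreover have "f \<in> borel_measurable lebesgue"
    by (rule continuous_imp_lebesgue_measurable[OF assms(1)])
  ultimately show ?thesis by (intro bounded_onI) auto
qed

lemma Cc_infinity_L2:
  fixes f :: "'a::euclidean_space \<Rightarrow> 'b::euclidean_space"
  assumes "f \<in> Cc_infinity"
  shows "f \<in> L2"
proof -
  have sm: "smooth f" and c: "compact (supp f)" using assms by (auto simp: Cc_infinity_def)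
  have 0: "f z = 0" if "z \<notin> supp f" for z
    using that closure_subset[of "{z. f z \<noteq> 0}"] by (auto simp: supp_def)
  have B: "f \<in> bounded_on (supp f)"
    by (rule continuous_imp_bounded_on[OF smooth_continuous_on[OF sm] c 0])
  have "integrable lebesgue (\<lambda>z. f z \<bullet> f z)"
    by (rule bounded_on_integrable[OF lmeasurable_compact[OF c] bounded_on_inner[OF B B]])
  with B show ?thesis by (simp add: L2_def bounded_on_def power2_norm_eq_inner)
qed

lemma L2_scaleR_integrable:
  fixes f :: "'a::euclidean_space \<Rightarrow> real" and g :: "'a \<Rightarrow> 'b::euclidean_space"
  assumes "f \<in> L2" "g \<in> L2"
  shows "integrable lebesgue (\<lambda>z. f z *\<^sub>R g z)"
proof (rule Bochner_Integration.integrable_bound)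
  show "integrable lebesgue (\<lambda>z. (norm (f z))\<^sup>2 + (norm (g z))\<^sup>2)"
    using assms by (auto simp: L2_def)
  show "(\<lambda>z. f z *\<^sub>R g z) \<in> borel_measurable lebesgue"
    using assms by (auto simp: L2_def)
  have "norm (f z *\<^sub>R g z) \<le> norm ((norm (f z))\<^sup>2 + (norm (g z))\<^sup>2)" for z
  proof -
    have "2 * (norm (f z) * norm (g z)) \<le> (norm (f z))\<^sup>2 + (norm (g z))\<^sup>2"
      using sum_squares_bound[of "norm (f z)" "norm (g z)"] by simp
    moreover have "0 \<le> norm (f z) * norm (g z)" by simp
    ultimately show ?thesis unfolding norm_scaleR real_norm_def by linarith
  qed
  then show "AE z in lebesgue. norm (f z *\<^sub>R g z) \<le> norm ((norm (f z))\<^sup>2 + (norm (g z))\<^sup>2)"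
    by simp
qed

text \<open>Young's inequality weighted by \<open>s\<close>, the L2 norm of \<open>f\<close>, gives
  two contributions of at most \<open>s / 2\<close> each. If that norm is zero, one cannot divide by
  it, but then \<open>f\<close> vanishes almost everywhere.\<close>

lemma L2_Cauchy_Schwarz_unit:
  fixes f :: "'a::euclidean_space \<Rightarrow> real" and g :: "'a \<Rightarrow> 'b::euclidean_space"
  assumes f: "f \<in> L2" and g: "g \<in> L2" and g1: "(LINT z|lebesgue. (norm (g z))\<^sup>2) \<le> 1"
  shows "norm (LINT z|lebesgue. f z *\<^sub>R g z) \<le> sqrt (LINT z|lebesgue. (f z)\<^sup>2)"
proof -
  define a where "a = (LINT z|lebesgue. (f z)\<^sup>2)"
  have fi: "integrable lebesgue (\<lambda>z. (f z)\<^sup>2)" and gi: "integrable lebesgue (\<lambda>z. (norm (g z))\<^sup>2)"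
    using f g by (auto simp: L2_def)
  have "a \<ge> 0" by (simp add: a_def)
  show ?thesis
  proof (cases "a = 0")
    case True
    then have "AE z in lebesgue. (f z)\<^sup>2 = 0"
      using integral_nonneg_eq_0_iff_AE[OF fi] by (simp add: a_def)
    then have "AE z in lebesgue. f z *\<^sub>R g z = 0" by eventually_elim simp
    then have "(LINT z|lebesgue. f z *\<^sub>R g z) = 0" by (rule integral_eq_zero_AE)
    then show ?thesis by simp
  next
    case False
    define s where "s = sqrt a"
    have s: "s > 0" "s * s = a" using False \<open>a \<ge> 0\<close> by (auto simp: s_def)
    have le: "norm (f z *\<^sub>R g z) \<le> (1 / (2 * s)) * (f z)\<^sup>2 + (s / 2) * (norm (g z))\<^sup>2" for z
    proof -
      have "2 * \<bar>f z\<bar> * (s * norm (g z)) \<le> \<bar>f z\<bar>\<^sup>2 + (s * norm (g z))\<^sup>2"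
        by (rule sum_squares_bound)
      then show ?thesis using s by (simp add: field_simps power2_eq_square)
    qed
    have "norm (LINT z|lebesgue. f z *\<^sub>R g z) \<le> (LINT z|lebesgue. norm (f z *\<^sub>R g z))"
      by (rule integral_norm_bound)
    also have "\<dots> \<le> (LINT z|lebesgue. (1 / (2 * s)) * (f z)\<^sup>2 + (s / 2) * (norm (g z))\<^sup>2)"
      using le by (intro integral_mono integrable_norm L2_scaleR_integrable f g
          Bochner_Integration.integrable_add integrable_mult_right fi gi) auto
    also have "\<dots> = (1 / (2 * s)) * a + (s / 2) * (LINT z|lebesgue. (norm (g z))\<^sup>2)"
      using fi gi by (simp add: a_def)
    also have "\<dots> \<le> (1 / (2 * s)) * a + (s / 2) * 1"
      using g1 s by (intro add_left_mono mult_left_mono) auto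
    also have "\<dots> = s" using s by (simp add: field_simps)
    finally show ?thesis by (simp add: s_def a_def)
  qed
qed

lemma frechet_derivative_Cc_infinity:
  assumes "f \<in> Cc_infinity"
  shows "(\<lambda>z. frechet_derivative f (at z) b) \<in> Cc_infinity"
  using assms frechet_derivative_eq_0_outside_supp
  by (intro Cc_infinityI[of _ "supp f"]) (auto simp: Cc_infinity_def smooth_frechet_derivative)

text \<open>Each entry of \<open>A\<close> is itself a test function, so the divergence can be moved
  onto \<open>\<phi>\<close> as a weak derivative. On the H1 unit ball every weak derivative has L2
  norm at most \<open>1\<close>, and Cauchy-Schwarz leaves the L2 norms of the entries.\<close>

lemma Hminus1_norm_matdiv_x_le:
  fixes A :: "'n::finite spacetime \<Rightarrow> real^'n^'n"
  assumes A: "\<And>i j. (\<lambda>z. A z $ i $ j) \<in> Cc_infinity"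
  shows "Hminus1_norm (matdiv_x A) \<le>
    ennreal (\<Sum>i\<in>UNIV. \<Sum>j\<in>UNIV. sqrt (LINT z|lebesgue. (A z $ i $ j)\<^sup>2))"
  unfolding Hminus1_norm_def
proof (intro SUP_least ennreal_leI)
  fix \<phi> :: "'n spacetime \<Rightarrow> real^'n"
  assume "\<phi> \<in> H1_unit_ball"
  then obtain G where \<phi>: "\<phi> \<in> L2" and G: "\<And>b. b \<in> Basis \<Longrightarrow> G b \<in> L2"
      "\<And>b. b \<in> Basis \<Longrightarrow> has_weak_deriv \<phi> b (G b)"
    and le1: "(LINT z|lebesgue. (norm (\<phi> z))\<^sup>2) + (\<Sum>b\<in>Basis. LINT z|lebesgue. (norm (G b z))\<^sup>2) \<le> 1"
    by (auto simp: H1_unit_ball_def)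
  have nn: "(LINT z|lebesgue. (norm (G b z))\<^sup>2) \<ge> 0" for b by simp
  have nn\<phi>: "(LINT z|lebesgue. (norm (\<phi> z))\<^sup>2) \<ge> 0" by simp
  have G1: "(LINT z|lebesgue. (norm (G b z))\<^sup>2) \<le> 1" if "b \<in> Basis" for b
  proof -
    have "(LINT z|lebesgue. (norm (G b z))\<^sup>2) \<le> (\<Sum>b\<in>Basis. LINT z|lebesgue. (norm (G b z))\<^sup>2)"
      using that by (intro member_le_sum) auto
    also have "\<dots> \<le> 1" using le1 nn\<phi> by linarith
    finally show ?thesis .
  qed
  define b where "b j = ((axis j 1, 0) :: 'n spacetime)" for j
  have bB: "b j \<in> Basis" for j
    by (auto simp: b_def Basis_prod_def Basis_vec_def)
  have D: "(\<lambda>z. dx j (\<lambda>y. A y $ i $ j) z) \<in> L2" for i j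
    unfolding dx_def by (intro Cc_infinity_L2 frechet_derivative_Cc_infinity A)
  have int: "integrable lebesgue (\<lambda>z. dx j (\<lambda>y. A y $ i $ j) z *\<^sub>R \<phi> z)" for i j
    using L2_scaleR_integrable[OF D \<phi>] .
  have int': "integrable lebesgue (\<lambda>z. dx j (\<lambda>y. A y $ i $ j) z * \<phi> z $ i)" for i j
    using integrable_inner_left[of "axis i 1", OF int] by (simp add: inner_axis)
  have "(LINT z|lebesgue. matdiv_x A z \<bullet> \<phi> z) =
     (LINT z|lebesgue. (\<Sum>i\<in>UNIV. \<Sum>j\<in>UNIV. dx j (\<lambda>y. A y $ i $ j) z * \<phi> z $ i))"
    by (simp add: matdiv_x_def inner_vec_def sum_distrib_right)
  also have "\<dots> = (\<Sum>i\<in>UNIV. \<Sum>j\<in>UNIV. (LINT z|lebesgue. dx j (\<lambda>y. A y $ i $ j) z * \<phi> z $ i))"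
    by (subst Bochner_Integration.integral_sum, intro Bochner_Integration.integrable_sum int')+
       (intro sum.cong refl Bochner_Integration.integral_sum int')
  also have "\<bar>\<dots>\<bar> \<le> (\<Sum>i\<in>UNIV. \<Sum>j\<in>UNIV. \<bar>LINT z|lebesgue. dx j (\<lambda>y. A y $ i $ j) z * \<phi> z $ i\<bar>)"
    by (intro order_trans[OF sum_abs] sum_mono sum_abs)
  also have "\<dots> \<le> (\<Sum>i\<in>UNIV. \<Sum>j\<in>UNIV. sqrt (LINT z|lebesgue. (A z $ i $ j)\<^sup>2))"
  proof (intro sum_mono)
    fix i j :: 'n
    \<comment> \<open>\<open>has_weak_deriv\<close> pairs a scalar test function with the
      vector-valued \<open>\<phi>\<close>, so the scalar integral is first read as the
      \<open>i\<close>-th coordinate of a vector-valued one.\<close>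
    have "(LINT z|lebesgue. dx j (\<lambda>y. A y $ i $ j) z * \<phi> z $ i) =
        (LINT z|lebesgue. dx j (\<lambda>y. A y $ i $ j) z *\<^sub>R \<phi> z) $ i"
      using integral_inner_left[OF int[of j i], of "axis i 1"] by (simp add: inner_axis)
    also have "\<bar>\<dots>\<bar> \<le> norm (LINT z|lebesgue. dx j (\<lambda>y. A y $ i $ j) z *\<^sub>R \<phi> z)"
      by (rule component_le_norm_cart)
    also have "(LINT z|lebesgue. dx j (\<lambda>y. A y $ i $ j) z *\<^sub>R \<phi> z) = - (LINT z|lebesgue. A z $ i $ j *\<^sub>R G (b j) z)"
      using G(2)[OF bB[of j]] A[of i j] unfolding has_weak_deriv_def dx_def b_def[symmetric] by blast
    also have "norm \<dots> \<le> sqrt (LINT z|lebesgue. (A z $ i $ j)\<^sup>2)"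
      using L2_Cauchy_Schwarz_unit[OF Cc_infinity_L2[OF A[of i j]] G(1)[OF bB[of j]] G1[OF bB[of j]]] by simp
    finally show "\<bar>LINT z|lebesgue. dx j (\<lambda>y. A y $ i $ j) z * \<phi> z $ i\<bar> \<le> sqrt (LINT z|lebesgue. (A z $ i $ j)\<^sup>2)" .
  qed
  finally show "\<bar>LINT z|lebesgue. matdiv_x A z \<bullet> \<phi> z\<bar> \<le> (\<Sum>i\<in>UNIV. \<Sum>j\<in>UNIV. sqrt (LINT z|lebesgue. (A z $ i $ j)\<^sup>2))" .
qed

section \<open>Subsolutions\<close>

text \<open>It measures the failure of the constraint defining \<open>K\<close>; its divergence is
  the force left over when a solution of the linear system is inserted into the Euler
  equations.\<close>

definition residual :: "real^'n::finite \<Rightarrow> real^'n^'n \<Rightarrow> real^'n^'n" where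
  "residual v u = outer v v - ((1 / real CARD('n)) * (norm v)\<^sup>2) *\<^sub>R mat 1 - u"

lemma residual_nth:
  "residual v u $ i $ j = v $ i * v $ j - (1 / real CARD('n)) * (norm v)\<^sup>2 * (if i = j then 1 else 0) - u $ i $ j"
  for v :: "real^'n::finite"
  by (simp add: residual_def outer_def mat_def)

text \<open>The residual is \<open>- defect v u\<close> plus a multiple of the identity with
  coefficient \<open>(1 - |v|^2) / n\<close>, and both parts are controlled by
  \<open>1 - |v|^2\<close>.\<close>

lemma norm_residual_le:
  fixes v :: "real^'n::finite"
  assumes "(v, u) \<in> convex hull K"
  shows "norm (residual v u) \<le> (1 + norm (mat 1 :: real^'n^'n)) * (1 - (norm v)\<^sup>2)"
proof -
  define c where "c = 1 / real CARD('n)"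
  have c: "0 \<le> c" "c \<le> 1" by (auto simp: c_def Suc_leI)
  note d = norm_defect_convex_hull_K[OF assms]
  then have v: "1 - (norm v)\<^sup>2 \<ge> 0" using norm_ge_zero order_trans by blast
  have "residual v u = - defect v u + (c * (1 - (norm v)\<^sup>2)) *\<^sub>R mat 1"
    by (simp add: residual_def defect_def c_def[symmetric] algebra_simps)
  also have "norm \<dots> \<le> norm (- defect v u) + norm ((c * (1 - (norm v)\<^sup>2)) *\<^sub>R (mat 1 :: real^'n^'n))"
    by (rule norm_triangle_ineq)
  also have "\<dots> \<le> (1 - (norm v)\<^sup>2) + (1 * (1 - (norm v)\<^sup>2)) * norm (mat 1 :: real^'n^'n)"
    using d v c by (intro add_mono) (auto simp: abs_mult intro!: mult_right_mono mult_left_le_one_le)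
  finally show ?thesis by (simp add: algebra_simps)
qed

lemma smooth_power2_norm:
  fixes v :: "'a::euclidean_space \<Rightarrow> 'b::euclidean_space"
  assumes "smooth v"
  shows "smooth (\<lambda>z. (norm (v z))\<^sup>2)"
  unfolding power2_norm_eq_inner by (rule smooth_bounded_bilinear[OF bounded_bilinear_inner assms assms])

text \<open>Subtracting the linear equation cancels \<open>dt v\<close> and \<open>grad_x q\<close>.
  What remains is the divergence of \<open>outer v v - u\<close> minus the gradient of
  \<open>|v|^2 / n\<close>, and that gradient is the divergence of \<open>|v|^2 / n\<close> times
  the identity.\<close>

lemma Euler_residual_eq:
  fixes v :: "'n::finite spacetime \<Rightarrow> real^'n"
  assumes sm: "smooth v" "smooth u" "smooth q"
    and eq: "dt v z + matdiv_x u z + grad_x q z = 0"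
  shows "dt v z + matdiv_x (\<lambda>y. outer (v y) (v y)) z
      + grad_x (\<lambda>y. q y - (1 / real CARD('n)) * (norm (v y))\<^sup>2) z
      = matdiv_x (\<lambda>y. residual (v y) (u y)) z"
proof -
  define s where "s y = (1 / real CARD('n)) * (norm (v y))\<^sup>2" for y
  have s: "smooth s" unfolding s_def
    by (rule smooth_mult[OF smooth_const smooth_power2_norm[OF sm(1)]])
  note D = smooth_differentiable
  have vv: "smooth (\<lambda>y. v y $ i * v y $ j)" for i j
    by (intro smooth_mult smooth_vec_nth sm)
  have uu: "smooth (\<lambda>y. u y $ i $ j)" for i j
    by (intro smooth_vec_nth sm)
  have sd: "smooth (\<lambda>y. s y * (if i = j then 1 else 0))" for i j :: 'n
    by (intro smooth_mult s smooth_const)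
  \<comment> \<open>Row \<open>i\<close> of a multiple of the identity has only its diagonal entry,
    so summing over \<open>j\<close> leaves \<open>dx i s\<close>.\<close>
  have dsd: "dx j (\<lambda>y. s y * (if i = j then 1 else 0)) z = (if i = j then dx i s z else 0)" for i j
    by (auto simp: dx_def frechet_derivative_const)
  have dr: "dx j (\<lambda>y. residual (v y) (u y) $ i $ j) z
     = dx j (\<lambda>y. v y $ i * v y $ j) z - (if i = j then dx i s z else 0) - dx j (\<lambda>y. u y $ i $ j) z" for i j
    unfolding residual_nth s_def[symmetric]
    using D[OF vv, of i j z] D[OF uu, of i j z] D[OF sd, of i j z] D[OF smooth_diff[OF vv sd], of i j i j z]
    by (subst dsd[symmetric]) (simp add: dx_def frechet_derivative_diff)
  have dp: "dx i (\<lambda>y. q y - s y) z = dx i q z - dx i s z" for i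
    using D[OF sm(3), of z] D[OF s, of z] by (simp add: dx_def frechet_derivative_diff)
  have "dt v z $ i + (\<Sum>j\<in>UNIV. dx j (\<lambda>y. u y $ i $ j) z) + dx i q z = 0" for i
    using eq by (simp add: vec_eq_iff matdiv_x_def grad_x_def)
  then have "dt v z $ i = - (\<Sum>j\<in>UNIV. dx j (\<lambda>y. u y $ i $ j) z) - dx i q z" for i
    by (simp add: eq_neg_iff_add_eq_0 algebra_simps)
  then show ?thesis
    unfolding s_def[symmetric]
    by (simp add: vec_eq_iff matdiv_x_def grad_x_def outer_def dr dp sum_subtractf)
qed

section \<open>Convexity of the set of smooth subsolutions\<close>

lemma X0_iff:
  "w \<in> X0 \<Omega> \<longleftrightarrow> smooth w \<and> supp w \<subseteq> \<Omega> \<and>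
    (\<forall>z. dt (\<lambda>z. fst (w z)) z + matdiv_x (\<lambda>z. fst (snd (w z))) z + grad_x (\<lambda>z. snd (snd (w z))) z = 0 \<and>
         div_x (\<lambda>z. fst (w z)) z = 0) \<and> (\<forall>z. w z \<in> U)"
  (is "?l \<longleftrightarrow> ?r")
proof
  assume ?r
  then show ?l unfolding X0_def
    by (auto intro!: exI[of _ "\<lambda>z. fst (w z)"] exI[of _ "\<lambda>z. fst (snd (w z))"] exI[of _ "\<lambda>z. snd (snd (w z))"])
qed (auto simp: X0_def)

text \<open>The system is linear, the support of a combination lies in the union of the supports,
  and \<open>U\<close> is convex.\<close>

lemma X0_convex:
  fixes f g :: "'n::finite spacetime \<Rightarrow> 'n state"
  assumes "f \<in> X0 \<Omega>" "g \<in> X0 \<Omega>" "0 \<le> t" "t \<le> 1"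
  shows "(\<lambda>z. (1 - t) *\<^sub>R f z + t *\<^sub>R g z) \<in> X0 \<Omega>"
proof -
  have sm: "smooth f" "smooth g" using assms by (auto simp: X0_iff)
  have bl: "bounded_linear (fst :: 'n state \<Rightarrow> real^'n)" "bounded_linear (\<lambda>w :: 'n state. snd (snd w))"
    by (auto intro!: bounded_linear_intros)
  let ?h = "\<lambda>z. (1 - t) *\<^sub>R f z + t *\<^sub>R g z"
  note df = smooth_differentiable[OF sm(1)] and dg = smooth_differentiable[OF sm(2)]
  note dsf = smooth_differentiable[OF smooth_scaleR[OF sm(1)]]
    and dsg = smooth_differentiable[OF smooth_scaleR[OF sm(2)]]
  have h': "frechet_derivative ?h (at z) b =
      (1 - t) *\<^sub>R frechet_derivative f (at z) b + t *\<^sub>R frechet_derivative g (at z) b" for z b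
    by (simp add: frechet_derivative_add[OF dsf dsg]
      frechet_derivative_bounded_linear[OF bounded_linear_scaleR_right df]
      frechet_derivative_bounded_linear[OF bounded_linear_scaleR_right dg])
  \<comment> \<open>Every quantity in the system is built from derivatives of bounded linear images
    of the state, so linearity is proved once for arbitrary \<open>L\<close> and then specialised to
    components.\<close>
  have lin_fd: "frechet_derivative (\<lambda>z. L (?h z)) (at z) b =
      (1 - t) *\<^sub>R frechet_derivative (\<lambda>z. L (f z)) (at z) b + t *\<^sub>R frechet_derivative (\<lambda>z. L (g z)) (at z) b"
    if L: "bounded_linear L" for L :: "'n state \<Rightarrow> 'c::real_normed_vector" and z b
  proof -
    have "frechet_derivative (\<lambda>z. L (?h z)) (at z) b = L (frechet_derivative ?h (at z) b)"
      using smooth_differentiable[OF smooth_add[OF smooth_scaleR[OF sm(1)] smooth_scaleR[OF sm(2)]]]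
      by (simp add: frechet_derivative_bounded_linear[OF L])
    also have "\<dots> = (1 - t) *\<^sub>R L (frechet_derivative f (at z) b) + t *\<^sub>R L (frechet_derivative g (at z) b)"
      unfolding h' using L by (simp add: bounded_linear.linear linear_add linear_scale)
    finally show ?thesis
      by (simp add: frechet_derivative_bounded_linear[OF L] df dg)
  qed
  have c: "bounded_linear (\<lambda>w :: 'n state. fst w $ i)" "bounded_linear (\<lambda>w :: 'n state. fst (snd w) $ i $ j)"
    for i j
    by (auto intro!: bounded_linear_intros bounded_linear_compose[OF bounded_linear_vec_nth])
  have mat: "matdiv_x (\<lambda>z. fst (snd (?h z))) z = (1 - t) *\<^sub>R matdiv_x (\<lambda>z. fst (snd (f z))) z
      + t *\<^sub>R matdiv_x (\<lambda>z. fst (snd (g z))) z" for z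
    using lin_fd[OF c(2)]
    by (simp add: dx_def matdiv_x_def vec_eq_iff sum.distrib sum_distrib_left)
  have grd: "grad_x (\<lambda>z. snd (snd (?h z))) z = (1 - t) *\<^sub>R grad_x (\<lambda>z. snd (snd (f z))) z
      + t *\<^sub>R grad_x (\<lambda>z. snd (snd (g z))) z" for z
    using lin_fd[OF bl(2)] by (simp add: dx_def grad_x_def vec_eq_iff)
  have dv: "div_x (\<lambda>z. fst (?h z)) z = (1 - t) * div_x (\<lambda>z. fst (f z)) z
      + t * div_x (\<lambda>z. fst (g z)) z" for z
    using lin_fd[OF c(1)] by (simp add: dx_def div_x_def sum.distrib sum_distrib_left)
  have dtv: "dt (\<lambda>z. fst (?h z)) z = (1 - t) *\<^sub>R dt (\<lambda>z. fst (f z)) z + t *\<^sub>R dt (\<lambda>z. fst (g z)) z" for z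
    using lin_fd[OF bl(1)] by (simp add: dt_def)
  have "dt (\<lambda>z. fst (?h z)) z + matdiv_x (\<lambda>z. fst (snd (?h z))) z + grad_x (\<lambda>z. snd (snd (?h z))) z
     = (1 - t) *\<^sub>R (dt (\<lambda>z. fst (f z)) z + matdiv_x (\<lambda>z. fst (snd (f z))) z + grad_x (\<lambda>z. snd (snd (f z))) z)
     + t *\<^sub>R (dt (\<lambda>z. fst (g z)) z + matdiv_x (\<lambda>z. fst (snd (g z))) z + grad_x (\<lambda>z. snd (snd (g z))) z)" for z
    unfolding mat grd dtv by (simp only: scaleR_add_right ac_simps)
  then have 1: "dt (\<lambda>z. fst (?h z)) z + matdiv_x (\<lambda>z. fst (snd (?h z))) z + grad_x (\<lambda>z. snd (snd (?h z))) z = 0" for z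
    using assms(1,2) by (simp only: X0_iff) simp
  have 2: "div_x (\<lambda>z. fst (?h z)) z = 0" for z
    unfolding dv using assms(1,2) by (simp add: X0_iff del: split_paired_All)
  have "supp ?h \<subseteq> supp f \<union> supp g"
    unfolding supp_def closure_Un[symmetric] by (intro closure_mono) auto
  with assms have 3: "supp ?h \<subseteq> \<Omega>" unfolding X0_iff by blast
  have 4: "?h z \<in> U" for z
    using assms convexD[OF convex_U, of "f z" "g z" "1 - t" t]
    by (simp add: X0_iff del: split_paired_All)
  show ?thesis unfolding X0_iff using 1 2 3 4 sm by (auto intro!: smooth_add smooth_scaleR)
qed

section \<open>Weak-star limits of subsolutions\<close>

lemma in_X_D:
  fixes w :: "'n::finite spacetime \<Rightarrow> 'n state"
  assumes "w \<in> X \<Omega>"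
  shows "w \<in> Linfty state_space"
    and "integrable lebesgue \<phi> \<Longrightarrow> e > 0 \<Longrightarrow>
        \<exists>g\<in>X0 \<Omega>. \<bar>(LINT z|lebesgue. g z \<bullet> \<phi> z) - (LINT z|lebesgue. w z \<bullet> \<phi> z)\<bar> < e"
proof -
  show w: "w \<in> Linfty state_space"
    using assms unfolding X_def in_closure_of Linfty_weak_star_def by auto
  assume \<phi>: "integrable lebesgue \<phi>" and e: "e > 0"
  \<comment> \<open>A subbasic neighbourhood of \<open>w\<close> given by a single test function;
    Mazur's argument tests against only one function at a time.\<close>
  let ?T = "{f \<in> Linfty state_space. (LINT z|lebesgue. f z \<bullet> \<phi> z) \<in> ball (LINT z|lebesgue. w z \<bullet> \<phi> z) e}"
  have "openin (Linfty_weak_star state_space) ?T"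
    unfolding Linfty_weak_star_def
    by (rule topology_generated_by_Basis) (use \<phi> open_ball in blast)
  moreover have "w \<in> ?T" using w e by simp
  moreover have "\<exists>g. g \<in> X0 \<Omega> \<and> g \<in> T"
    if "openin (Linfty_weak_star state_space) T" "w \<in> T" for T
    using assms that unfolding X_def in_closure_of by blast
  ultimately obtain g where "g \<in> X0 \<Omega>" "g \<in> ?T" by meson
  then show "\<exists>g\<in>X0 \<Omega>. \<bar>(LINT z|lebesgue. g z \<bullet> \<phi> z) - (LINT z|lebesgue. w z \<bullet> \<phi> z)\<bar> < e"
    by (auto simp: dist_real_def abs_minus_commute)
qed

lemma X0_eq_0_outside: "w \<in> X0 \<Omega> \<Longrightarrow> z \<notin> \<Omega> \<Longrightarrow> w z = 0"
proof (rule ccontr)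
  assume w: "w \<in> X0 \<Omega>" and z: "z \<notin> \<Omega>" "w z \<noteq> 0"
  from w have "supp w \<subseteq> \<Omega>" unfolding X0_iff by blast
  with z closure_subset[of "{z. w z \<noteq> 0}"] show False unfolding supp_def by blast
qed

text \<open>Members of \<open>X0 \<Omega>\<close> pair to zero with any function living off
  \<open>\<Omega>\<close>, hence so does their weak-star limit. Testing \<open>w\<close> with its
  own truncation makes the integral of \<open>|w|^2\<close> there vanish.\<close>

lemma X_eq_0_outside:
  fixes w :: "'n::finite spacetime \<Rightarrow> 'n state"
  assumes "open \<Omega>" "w \<in> X \<Omega>"
  shows "AE z in lebesgue. z \<notin> \<Omega> \<longrightarrow> w z = 0"
proof -
  obtain C where C: "AE z in lebesgue. norm (w z) \<le> C"
    and [measurable]: "w \<in> borel_measurable lebesgue"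
    using in_X_D(1)[OF assms(2)] by (auto simp: Linfty_def)
  \<comment> \<open>The complement of \<open>\<Omega>\<close> may have infinite measure. Cutting it
    off by a ball makes the truncation of \<open>w\<close> integrable, and countably many balls
    exhaust the space.\<close>
  have "AE z in lebesgue. z \<in> ball 0 (real m) - \<Omega> \<longrightarrow> w z = 0" for m
  proof -
    define S where "S = ball 0 (real m) - \<Omega>"
    have S: "S \<in> lmeasurable" unfolding S_def
      by (intro fmeasurable_Diff lmeasurable_ball) (use assms(1) in auto)
    then have [measurable]: "S \<in> sets lebesgue" by (auto simp: fmeasurable_def)
    define \<phi> where "\<phi> z = indicator S z *\<^sub>R w z" for z
    have [measurable]: "\<phi> \<in> borel_measurable lebesgue" unfolding \<phi>_def by measurable
    have \<phi>B: "\<phi> \<in> bounded_on S"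
      by (rule bounded_onI[where C=C]) (use C in \<open>auto simp: \<phi>_def indicator_def elim!: AE_mp\<close>)
    have "(LINT z|lebesgue. g z \<bullet> \<phi> z) = 0" if "g \<in> X0 \<Omega>" for g
    proof -
      have "(\<lambda>z. g z \<bullet> \<phi> z) = (\<lambda>_. 0)"
      proof
        show "g z \<bullet> \<phi> z = 0" for z
          using X0_eq_0_outside[OF that, of z] by (cases "z \<in> \<Omega>") (auto simp: \<phi>_def S_def)
      qed
      then show ?thesis by simp
    qed
    then have small: "\<bar>LINT z|lebesgue. w z \<bullet> \<phi> z\<bar> < e" if "e > 0" for e
      using in_X_D(2)[OF assms(2) bounded_on_integrable[OF S \<phi>B] that] by auto
    have "(LINT z|lebesgue. w z \<bullet> \<phi> z) = 0"
    proof (rule ccontr)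
      assume "(LINT z|lebesgue. w z \<bullet> \<phi> z) \<noteq> 0"
      then show False using small[of "\<bar>LINT z|lebesgue. w z \<bullet> \<phi> z\<bar>"] by simp
    qed
    moreover have eq: "(\<lambda>z. w z \<bullet> \<phi> z) = (\<lambda>z. \<phi> z \<bullet> \<phi> z)" by (auto simp: \<phi>_def indicator_def)
    moreover have "integrable lebesgue (\<lambda>z. \<phi> z \<bullet> \<phi> z)"
      by (rule bounded_on_integrable[OF S bounded_on_inner[OF \<phi>B \<phi>B]])
    ultimately have "AE z in lebesgue. \<phi> z \<bullet> \<phi> z = 0"
      using integral_nonneg_eq_0_iff_AE[of lebesgue "\<lambda>z. \<phi> z \<bullet> \<phi> z"] by simp
    then show ?thesis
      by eventually_elim (auto simp: \<phi>_def S_def)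
  qed
  then have "AE z in lebesgue. \<forall>m. z \<in> ball 0 (real m) - \<Omega> \<longrightarrow> w z = 0"
    by (subst AE_all_countable) blast
  then show ?thesis
  proof eventually_elim
    case (elim z)
    then show ?case using reals_Archimedean2[of "norm z"] by auto
  qed
qed

section \<open>Uniform bounds and strong approximation\<close>

lemma U_D:
  assumes "(v, u, q) \<in> U"
  shows "(v, u) \<in> convex hull K" "\<bar>q\<bar> \<le> 1"
proof -
  have "(v, u, q) \<in> {(v, u, q). (v, u) \<in> convex hull K \<and> q \<in> {-1..1}}"
    using assms unfolding U_def by (rule subsetD[OF interior_of_subset])
  then show "(v, u) \<in> convex hull K" "\<bar>q\<bar> \<le> 1" by (simp_all add: abs_le_iff)
qed

lemma convex_hull_K_norm_le_1:
  assumes "(v, u) \<in> convex hull K"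
  shows "norm v \<le> 1"
proof -
  have "0 \<le> 1 - (norm v)\<^sup>2" using norm_defect_convex_hull_K[OF assms] norm_ge_zero order_trans by blast
  then show ?thesis by (simp add: abs_square_le_1)
qed

text \<open>The component \<open>u\<close> is recovered from its defect: the bounds
  \<open>1 - |v|^2\<close> for the defect and \<open>|v|^2\<close> for \<open>outer v v\<close> add
  up to \<open>1\<close>. The resulting constant depends only on the dimension and serves as
  \<open>M\<close> in Mazur's lemma.\<close>

lemma norm_U_le:
  fixes w :: "'n::finite state"
  assumes "w \<in> U"
  shows "norm w \<le> 4 + norm ((1 / real CARD('n)) *\<^sub>R (mat 1 :: real^'n^'n))"
proof -
  obtain v u q where w: "w = (v, u, q)" by (cases w) auto
  note h = U_D[OF assms[unfolded w]]
  have v: "norm v \<le> 1" by (rule convex_hull_K_norm_le_1[OF h(1)])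
  have "u = defect v u - (1 / real CARD('n)) *\<^sub>R mat 1 + outer v v" by (simp add: defect_def)
  also have "norm \<dots> \<le> norm (defect v u) + norm ((1 / real CARD('n)) *\<^sub>R (mat 1 :: real^'n^'n)) + (norm v)\<^sup>2"
    unfolding norm_outer[symmetric]
    by (intro order_trans[OF norm_triangle_ineq] add_right_mono norm_triangle_ineq4)
  also have "\<dots> \<le> 1 + norm ((1 / real CARD('n)) *\<^sub>R (mat 1 :: real^'n^'n))"
    using norm_defect_convex_hull_K[OF h(1)] by simp
  finally have u: "norm u \<le> 1 + norm ((1 / real CARD('n)) *\<^sub>R (mat 1 :: real^'n^'n))" .
  have "norm w \<le> norm v + (norm u + norm q)"
    unfolding w by (intro order_trans[OF norm_Pair_le] add_mono norm_Pair_le order_refl)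
  with u v h(2) show ?thesis by simp
qed

text \<open>Membership in a weak-star closure is not by itself a statement about sequences. Mazur's
  lemma supplies approximants whose L2 distance to \<open>w\<close> tends to zero, and a subsequence
  of them converges almost everywhere.\<close>

lemma X_AE_limit_of_X0:
  fixes w :: "'n::finite spacetime \<Rightarrow> 'n state"
  assumes \<Omega>: "open \<Omega>" "bounded \<Omega>" and w: "w \<in> X \<Omega>"
  obtains W where "\<And>k::nat. W k \<in> X0 \<Omega>" "AE z in lebesgue. (\<lambda>k. W k z) \<longlonglongrightarrow> w z"
proof -
  have \<Omega>m: "\<Omega> \<in> lmeasurable" using \<Omega> by (intro lmeasurable_open)
  define M where "M = 4 + norm ((1 / real CARD('n)) *\<^sub>R (mat 1 :: real^'n^'n))"
  have meas: "f \<in> borel_measurable lebesgue" if "f \<in> X0 \<Omega>" for f :: "'n spacetime \<Rightarrow> 'n state"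
    using that by (auto simp: X0_iff intro: continuous_imp_lebesgue_measurable smooth_continuous_on)
  have bnd: "norm (f z) \<le> M * indicator \<Omega> z" if "f \<in> X0 \<Omega>" for f and z :: "'n spacetime"
    using X0_eq_0_outside[OF that, of z] that norm_U_le[of "f z"]
    by (cases "z \<in> \<Omega>") (auto simp: X0_iff M_def simp del: split_paired_All)
  obtain C where C: "AE z in lebesgue. norm (w z) \<le> C" and wm: "w \<in> borel_measurable lebesgue"
    using in_X_D(1)[OF w] by (auto simp: Linfty_def)
  have "AE z in lebesgue. norm (w z) \<le> C * indicator \<Omega> z"
    using C X_eq_0_outside[OF \<Omega>(1) w]
    by eventually_elim (auto simp: indicator_def)
  then have wB: "w \<in> bounded_on \<Omega>" by (rule bounded_onI[OF wm])
  have "\<exists>f\<in>X0 \<Omega>. (LINT z|lebesgue. (norm (f z - w z))\<^sup>2) < 1 / real (Suc k)" for k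
  proof (rule L2_approx_of_weak_closure[where F = "X0 \<Omega>" and w = w and \<Omega> = \<Omega> and M = M])
    show "\<exists>g\<in>X0 \<Omega>. \<bar>(LINT z|lebesgue. g z \<bullet> \<phi> z) - (LINT z|lebesgue. w z \<bullet> \<phi> z)\<bar> < e"
      if "integrable lebesgue \<phi>" "e > 0" for \<phi> e
      by (rule in_X_D(2)[OF w that])
    show "(\<lambda>z. (1 - t) *\<^sub>R f z + t *\<^sub>R g z) \<in> X0 \<Omega>"
      if "f \<in> X0 \<Omega>" "g \<in> X0 \<Omega>" "0 \<le> t" "t \<le> 1" for f g t
      by (rule X0_convex[OF that])
  qed (simp_all add: \<Omega>m meas bnd wB)
  then have "\<exists>V. \<forall>k. V k \<in> X0 \<Omega> \<and> (LINT z|lebesgue. (norm (V k z - w z))\<^sup>2) < 1 / real (Suc k)"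
    by (intro choice allI) blast
  then obtain V where V: "\<And>k. V k \<in> X0 \<Omega>"
    and Vw: "\<And>k. (LINT z|lebesgue. (norm (V k z - w z))\<^sup>2) < 1 / real (Suc k)" by blast
  have VB: "V k \<in> bounded_on \<Omega>" for k
    by (rule bounded_onI[where C = M, OF meas[OF V]]) (simp add: bnd[OF V])
  have int: "integrable lebesgue (\<lambda>z. (norm (V k z - w z))\<^sup>2)" for k
    unfolding power2_norm_eq_inner
    by (rule bounded_on_integrable[OF \<Omega>m bounded_on_inner[OF bounded_on_diff[OF VB wB] bounded_on_diff[OF VB wB]]])
  have "(\<lambda>k. LINT z|lebesgue. norm ((norm (V k z - w z))\<^sup>2)) \<longlonglongrightarrow> 0"
  proof (rule real_tendsto_sandwich[where f = "\<lambda>_. 0" and h = "\<lambda>k. 1 / real (Suc k)"])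
    show "(\<lambda>k. 1 / real (Suc k)) \<longlonglongrightarrow> 0" using LIMSEQ_inverse_real_of_nat by (simp add: inverse_eq_divide)
    show "(\<lambda>_. 0) \<longlonglongrightarrow> (0::real)" by simp
    show "\<forall>\<^sub>F k in sequentially. (LINT z|lebesgue. norm ((norm (V k z - w z))\<^sup>2)) \<le> 1 / real (Suc k)"
      using less_imp_le[OF Vw] by simp
  qed simp
  \<comment> \<open>L2 convergence is read as L1 convergence of the squared distances.\<close>
  from tendsto_L1_AE_subseq[OF int this] obtain r :: "nat \<Rightarrow> nat" where
    "AE z in lebesgue. (\<lambda>k. (norm (V (r k) z - w z))\<^sup>2) \<longlonglongrightarrow> 0"
    by blast
  then have "AE z in lebesgue. (\<lambda>k. V (r k) z) \<longlonglongrightarrow> w z"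
  proof eventually_elim
    case (elim z)
    then have "(\<lambda>k. norm (V (r k) z - w z)) \<longlonglongrightarrow> 0"
      using tendsto_real_sqrt[OF elim] by simp
    then show ?case by (simp add: LIM_zero_iff tendsto_norm_zero_iff)
  qed
  with V show thesis by (rule that)
qed

section \<open>Dominated convergence on a set of finite measure\<close>

lemma tendsto_Lr_dominated:
  fixes F :: "nat \<Rightarrow> 'a::euclidean_space \<Rightarrow> 'b::euclidean_space"
  assumes \<Omega>: "\<Omega> \<in> lmeasurable" and r: "r > 0"
    and m: "\<And>k. F k \<in> borel_measurable lebesgue" "f \<in> borel_measurable lebesgue"
    and b: "\<And>k z. norm (F k z) \<le> M * indicator \<Omega> z"
    and l: "AE z in lebesgue. (\<lambda>k. F k z) \<longlonglongrightarrow> f z"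
  shows "tendsto_Lr r F f"
proof -
  note m[measurable]
  have [measurable]: "\<Omega> \<in> sets lebesgue" using \<Omega> by (auto simp: fmeasurable_def)
  have "(\<lambda>k. \<integral>\<^sup>+z. ennreal (norm (F k z - f z) powr r) \<partial>lebesgue) \<longlonglongrightarrow> (\<integral>\<^sup>+(z::'a). 0 \<partial>lebesgue)"
  proof (rule nn_integral_dominated_convergence[where u' = "\<lambda>_. 0" and w = "\<lambda>z. ennreal ((2 * M) powr r) * indicator \<Omega> z"])
    show "AE z in lebesgue. ennreal (norm (F k z - f z) powr r) \<le> ennreal ((2 * M) powr r) * indicator \<Omega> z" for k
      using l
    proof eventually_elim
      case (elim z)
      \<comment> \<open>The bound passes to the limit, so the difference is at most
        \<open>2 * M\<close> on \<open>\<Omega>\<close> and zero outside, which gives the integrable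
        majorant.\<close>
      have fz: "norm (f z) \<le> M * indicator \<Omega> z"
        by (rule LIMSEQ_le_const2[OF tendsto_norm[OF elim]]) (use b in auto)
      have le: "norm (F k z - f z) \<le> 2 * M * indicator \<Omega> z"
        using norm_triangle_ineq4[of "F k z" "f z"] fz b[of k z] by simp
      show ?case
      proof (cases "z \<in> \<Omega>")
        case True
        then have "norm (F k z - f z) powr r \<le> (2 * M) powr r"
          using le r by (intro powr_mono2) auto
        then show ?thesis using True by (simp add: ennreal_leI)
      next
        case False
        then show ?thesis using le by simp
      qed
    qed
    show "(\<integral>\<^sup>+z. ennreal ((2 * M) powr r) * indicator \<Omega> z \<partial>lebesgue) < \<infinity>"
      using \<Omega> by (simp add: nn_integral_cmult_indicator fmeasurable_def ennreal_mult_less_top)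
    show "AE z in lebesgue. (\<lambda>k. ennreal (norm (F k z - f z) powr r)) \<longlonglongrightarrow> 0"
      using l
    proof eventually_elim
      case (elim z)
      then have "(\<lambda>k. norm (F k z - f z)) \<longlonglongrightarrow> 0"
        by (simp add: LIM_zero_iff tendsto_norm_zero_iff)
      \<comment> \<open>Positivity of \<open>r\<close> gives continuity of the power at base
        \<open>0\<close>.\<close>
      then have "(\<lambda>k. norm (F k z - f z) powr r) \<longlonglongrightarrow> 0 powr r"
        by (rule tendsto_powr2) (use r in auto)
      then show ?case using r by (simp add: tendsto_ennreal_iff flip: ennreal_0)
    qed
  qed measurable
  then show ?thesis by (simp add: tendsto_Lr_def)
qed

lemma integral_square_tendsto_0:
  fixes F :: "nat \<Rightarrow> 'a::euclidean_space \<Rightarrow> real"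
  assumes \<Omega>: "\<Omega> \<in> lmeasurable"
    and m: "\<And>k. F k \<in> borel_measurable lebesgue"
    and b: "\<And>k z. \<bar>F k z\<bar> \<le> M * indicator \<Omega> z"
    and l: "AE z in lebesgue. (\<lambda>k. F k z) \<longlonglongrightarrow> 0"
  shows "(\<lambda>k. LINT z|lebesgue. (F k z)\<^sup>2) \<longlonglongrightarrow> 0"
proof -
  note m[measurable]
  have [measurable]: "\<Omega> \<in> sets lebesgue" using \<Omega> by (auto simp: fmeasurable_def)
  have "(\<lambda>k. LINT z|lebesgue. (F k z)\<^sup>2) \<longlonglongrightarrow> (LINT (z::'a)|lebesgue. (0::real))"
  proof (rule integral_dominated_convergence[where w = "\<lambda>z. M\<^sup>2 * indicator \<Omega> z"])
    show "integrable lebesgue (\<lambda>z. M\<^sup>2 * indicator \<Omega> z)"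
      using \<Omega> by (intro integrable_mult_right integrable_real_indicator) (auto simp: fmeasurable_def)
    show "AE z in lebesgue. (\<lambda>k. (F k z)\<^sup>2) \<longlonglongrightarrow> 0"
      using l by eventually_elim (use tendsto_power[where n=2] in fastforce)
    have "norm ((F k z)\<^sup>2) \<le> M\<^sup>2 * indicator \<Omega> z" for k z
      using b[of k z] by (cases "z \<in> \<Omega>") (auto intro: power2_le_iff_abs_le[THEN iffD2] simp: abs_le_square_iff[symmetric])
    then show "AE z in lebesgue. norm ((F k z)\<^sup>2) \<le> M\<^sup>2 * indicator \<Omega> z" for k by simp
  qed measurable
  then show ?thesis by simp
qed

theorem theorem1p3:
  fixes \<Omega> :: "'n::finite spacetime set"
    and v :: "'n spacetime \<Rightarrow> real^'n"
    and u :: "'n spacetime \<Rightarrow> real^'n^'n"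
    and q p :: "'n spacetime \<Rightarrow> real"
  assumes "CARD('n) \<ge> 2"
    and "open \<Omega>" and "bounded \<Omega>"
    and "(\<lambda>z. (v z, u z, q z)) \<in> X \<Omega>"
    and "AE z in lebesgue. z \<in> \<Omega> \<longrightarrow> norm (v z) = 1"
    and "p = (\<lambda>z. q z - (1 / real CARD('n)) * (norm (v z))\<^sup>2)"
  shows "\<exists>(vk :: nat \<Rightarrow> 'n spacetime \<Rightarrow> real^'n) (fk :: nat \<Rightarrow> 'n spacetime \<Rightarrow> real^'n)
            (pk :: nat \<Rightarrow> 'n spacetime \<Rightarrow> real).
           (\<forall>k. vk k \<in> Cc_infinity \<and> fk k \<in> Cc_infinity \<and> pk k \<in> Cc_infinity) \<and>
           (\<forall>k z. dt (vk k) z + matdiv_x (\<lambda>y. outer (vk k y) (vk k y)) z + grad_x (pk k) z = fk k z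
                  \<and> div_x (vk k) z = 0) \<and>
           (\<lambda>k. Hminus1_norm (fk k)) \<longlonglongrightarrow> 0 \<and>
           (\<exists>C::real. \<forall>k. sup_norm (vk k) + sup_norm (pk k) \<le> ennreal C) \<and>
           (\<forall>r\<ge>1. tendsto_Lr r (\<lambda>k z. (vk k z, pk k z)) (\<lambda>z. (v z, p z)))"
proof -
  obtain W where W: "\<And>k::nat. W k \<in> X0 \<Omega>"
    and lim: "AE z in lebesgue. (\<lambda>k. W k z) \<longlonglongrightarrow> (v z, u z, q z)"
    using X_AE_limit_of_X0[OF assms(2,3,4)] by blast
  define c where "c = 1 / real CARD('n)"
  have c: "0 \<le> c" "c \<le> 1" by (auto simp: c_def Suc_leI)
  define vk where "vk k z = fst (W k z)" for k z
  define uk where "uk k z = fst (snd (W k z))" for k z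
  define qk where "qk k z = snd (snd (W k z))" for k z
  \<comment> \<open>The same shift as in \<open>p\<close>; it turns the force into the divergence of
    the residual.\<close>
  define pk where "pk k z = qk k z - c * (norm (vk k z))\<^sup>2" for k z
  define A where "A k z = residual (vk k z) (uk k z)" for k z
  define fk where "fk k z = matdiv_x (A k) z" for k z
  have \<Omega>m: "\<Omega> \<in> lmeasurable" using assms(2,3) by (intro lmeasurable_open)
  have WU: "(vk k z, uk k z, qk k z) \<in> U" for k z
    using W[of k] by (simp add: X0_iff vk_def uk_def qk_def del: split_paired_All)
  note hull = U_D(1)[OF WU] and q1 = U_D(2)[OF WU]
  note v1 = convex_hull_K_norm_le_1[OF hull]

  \<comment> \<open>Smoothness, compact support and the equations\<close>
  have smW: "smooth (W k)" for k using W[of k] by (simp add: X0_iff)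
  have smv: "smooth (vk k)" for k
    using smooth_bounded_linear[OF bounded_linear_fst smW[of k]] by (simp add: vk_def[abs_def])
  have smu: "smooth (uk k)" for k
    using smooth_bounded_linear[OF bounded_linear_fst smooth_bounded_linear[OF bounded_linear_snd smW[of k]]]
    by (simp add: uk_def[abs_def])
  have smq: "smooth (qk k)" for k
    using smooth_bounded_linear[OF bounded_linear_snd smooth_bounded_linear[OF bounded_linear_snd smW[of k]]]
    by (simp add: qk_def[abs_def])
  have smp: "smooth (pk k)" for k
    unfolding pk_def by (intro smooth_diff smooth_mult smooth_const smooth_power2_norm smq smv)
  have smA: "smooth (\<lambda>z. A k z $ i $ j)" for k i j
    unfolding A_def residual_nth
    by (intro smooth_diff smooth_mult smooth_const smooth_power2_norm smooth_vec_nth smu smv)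
  have smf: "smooth (fk k)" for k
    unfolding fk_def[abs_def] matdiv_x_def dx_def
    by (intro smooth_vec_lambda smooth_sum smooth_frechet_derivative smA)
  define S where "S k = supp (W k)" for k
  have S\<Omega>: "S k \<subseteq> \<Omega>" for k using W[of k] by (simp add: S_def X0_iff)
  \<comment> \<open>The support is closed and contained in the bounded set \<open>\<Omega>\<close>;
    velocity, pressure and residual all vanish where \<open>W k\<close> does.\<close>
  have S: "compact (S k)" for k
    using S\<Omega>[of k] assms(3) bounded_subset by (auto simp: S_def supp_def compact_eq_bounded_closed)
  have W0: "W k z = 0" if "z \<notin> S k" for k z
    using that closure_subset[of "{z. W k z \<noteq> 0}"] by (auto simp: S_def supp_def)
  have v0: "vk k z = 0" and p0: "pk k z = 0" and A0: "A k z $ i $ j = 0" if "z \<notin> S k" for k z i j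
    using W0[OF that] by (simp_all add: vk_def pk_def uk_def qk_def A_def residual_nth)
  have vC: "vk k \<in> Cc_infinity" and pC: "pk k \<in> Cc_infinity" and AC: "(\<lambda>z. A k z $ i $ j) \<in> Cc_infinity" for k i j
    using Cc_infinityI[OF smv S v0] Cc_infinityI[OF smp S p0] Cc_infinityI[OF smA S A0] by blast+
  have f0: "fk k z = 0" if "z \<notin> S k" for k z
  proof -
    have "supp (\<lambda>z. A k z $ i $ j) \<subseteq> S k" for i j
      using A0[where k = k] compact_imp_closed[OF S] unfolding supp_def by (intro closure_minimal) blast+
    then have "frechet_derivative (\<lambda>y. A k y $ i $ j) (at z) b = 0" for i j b
      using that by (intro frechet_derivative_eq_0_outside_supp) blast
    then show ?thesis by (simp add: fk_def matdiv_x_def dx_def vec_eq_iff)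
  qed
  have fC: "fk k \<in> Cc_infinity" for k by (rule Cc_infinityI[OF smf S f0])
  have X0eq: "dt (vk k) z + matdiv_x (uk k) z + grad_x (qk k) z = 0 \<and> div_x (vk k) z = 0" for k z
    using W[of k] by (simp add: X0_iff vk_def[abs_def] uk_def[abs_def] qk_def[abs_def] del: split_paired_All)
  have eqs: "dt (vk k) z + matdiv_x (\<lambda>y. outer (vk k y) (vk k y)) z + grad_x (pk k) z = fk k z
      \<and> div_x (vk k) z = 0" for k z
    using Euler_residual_eq[OF smv smu smq conjunct1[OF X0eq], of k z] X0eq[of k z]
    by (simp add: pk_def[abs_def] c_def fk_def A_def[abs_def])

  \<comment> \<open>Almost everywhere limits of velocity and pressure\<close>
  have limv: "AE z in lebesgue. (\<lambda>k. vk k z) \<longlonglongrightarrow> v z"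
    using lim by eventually_elim (auto simp: vk_def dest: tendsto_fst)
  have limq: "AE z in lebesgue. (\<lambda>k. qk k z) \<longlonglongrightarrow> q z"
    using lim by eventually_elim (auto simp: qk_def dest!: tendsto_snd)
  have limp: "AE z in lebesgue. (\<lambda>k. pk k z) \<longlonglongrightarrow> p z"
    using limv limq unfolding pk_def assms(6) c_def[symmetric]
    by eventually_elim (intro tendsto_intros)

  \<comment> \<open>Decay of the residual and of the force\<close>
  define L where "L = 1 + norm (mat 1 :: real^'n^'n)"
  have L0: "L \<ge> 0" by (simp add: L_def)
  have An: "\<bar>A k z $ i $ j\<bar> \<le> L * (1 - (norm (vk k z))\<^sup>2)" for k z i j
  proof -
    have "\<bar>A k z $ i $ j\<bar> \<le> norm (A k z)"
      by (rule order_trans[OF component_le_norm_cart Finite_Cartesian_Product.norm_nth_le])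
    also have "\<dots> \<le> L * (1 - (norm (vk k z))\<^sup>2)"
      unfolding A_def L_def by (rule norm_residual_le[OF hull])
    finally show ?thesis .
  qed
  have Ab: "\<bar>A k z $ i $ j\<bar> \<le> L * indicator \<Omega> z" for k z i j
  proof (cases "z \<in> \<Omega>")
    case True
    have "L * (1 - (norm (vk k z))\<^sup>2) \<le> L * 1" using L0 by (intro mult_left_mono) auto
    with An[of k z i j] True show ?thesis by simp
  next
    case False
    then show ?thesis using A0[of z k i j] S\<Omega>[of k] by auto
  qed
  \<comment> \<open>The saturation \<open>|v| = 1\<close> enters here: on \<open>\<Omega>\<close>
    the majorant \<open>L * (1 - |vk|^2)\<close> tends to \<open>L * (1 - |v|^2) = 0\<close>, and
    off \<open>\<Omega>\<close> the entries are zero.\<close>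
  have Alim: "AE z in lebesgue. (\<lambda>k. A k z $ i $ j) \<longlonglongrightarrow> 0" for i j
    using limv assms(5)
  proof eventually_elim
    case (elim z)
    show ?case
    proof (cases "z \<in> \<Omega>")
      case True
      have "(\<lambda>k. L * (1 - (norm (vk k z))\<^sup>2)) \<longlonglongrightarrow> L * (1 - (norm (v z))\<^sup>2)"
        by (intro tendsto_intros elim)
      then have "(\<lambda>k. L * (1 - (norm (vk k z))\<^sup>2)) \<longlonglongrightarrow> 0" using True elim by simp
      then show ?thesis
        by (rule Lim_null_comparison[rotated]) (use An in auto)
    next
      case False
      then have "A k z $ i $ j = 0" for k using Ab[of k z i j] by simp
      then show ?thesis by simp
    qed
  qed
  have Am: "(\<lambda>z. A k z $ i $ j) \<in> borel_measurable lebesgue" for k i j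
    by (rule continuous_imp_lebesgue_measurable[OF smooth_continuous_on[OF smA]])
  have sq: "(\<lambda>k. LINT z|lebesgue. (A k z $ i $ j)\<^sup>2) \<longlonglongrightarrow> 0" for i j
    by (rule integral_square_tendsto_0[OF \<Omega>m Am Ab Alim])
  have sqs: "(\<lambda>k. \<Sum>i\<in>UNIV. \<Sum>j\<in>UNIV. sqrt (LINT z|lebesgue. (A k z $ i $ j)\<^sup>2)) \<longlonglongrightarrow> 0"
    using tendsto_real_sqrt[OF sq] by (intro tendsto_null_sum) simp
  have H: "(\<lambda>k. Hminus1_norm (fk k)) \<longlonglongrightarrow> 0"
  proof (rule tendsto_sandwich[where f = "\<lambda>_. 0"])
    show "\<forall>\<^sub>F k in sequentially. Hminus1_norm (fk k) \<le>
        ennreal (\<Sum>i\<in>UNIV. \<Sum>j\<in>UNIV. sqrt (LINT z|lebesgue. (A k z $ i $ j)\<^sup>2))"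
      using Hminus1_norm_matdiv_x_le[OF AC] by (simp add: fk_def[abs_def])
    show "(\<lambda>k. ennreal (\<Sum>i\<in>UNIV. \<Sum>j\<in>UNIV. sqrt (LINT z|lebesgue. (A k z $ i $ j)\<^sup>2))) \<longlonglongrightarrow> 0"
      using tendsto_ennrealI[OF sqs] by simp
  qed auto

  \<comment> \<open>Uniform bounds\<close>
  have pb: "\<bar>pk k z\<bar> \<le> 2" for k z
  proof -
    have "c * (norm (vk k z))\<^sup>2 \<le> 1 * 1"
      using v1[of k z] c by (intro mult_mono) (auto simp: abs_square_le_1)
    moreover have "0 \<le> c * (norm (vk k z))\<^sup>2" using c by simp
    ultimately show ?thesis using q1[of k z] unfolding pk_def by linarith
  qed
  have "sup_norm (vk k) + sup_norm (pk k) \<le> ennreal 3" for k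
  proof -
    have "sup_norm (vk k) \<le> ennreal 1"
      unfolding sup_norm_def by (intro SUP_least ennreal_leI v1)
    moreover have "sup_norm (pk k) \<le> ennreal 2"
      unfolding sup_norm_def real_norm_def by (intro SUP_least ennreal_leI pb)
    ultimately have "sup_norm (vk k) + sup_norm (pk k) \<le> ennreal 1 + ennreal 2" by (rule add_mono)
    then show ?thesis by (simp flip: ennreal_plus)
  qed
  then have bdd: "\<exists>C::real. \<forall>k. sup_norm (vk k) + sup_norm (pk k) \<le> ennreal C" by blast

  \<comment> \<open>Strong convergence of velocity and pressure\<close>
  have conv: "tendsto_Lr r (\<lambda>k z. (vk k z, pk k z)) (\<lambda>z. (v z, p z))" if "r \<ge> 1" for r
  proof (rule tendsto_Lr_dominated[OF \<Omega>m])
    show "r > 0" using that by simp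
    have vm: "vk k \<in> borel_measurable lebesgue" and pm: "pk k \<in> borel_measurable lebesgue" for k
      by (auto intro: continuous_imp_lebesgue_measurable smooth_continuous_on smv smp)
    then show "(\<lambda>z. (vk k z, pk k z)) \<in> borel_measurable lebesgue" for k by (intro borel_measurable_Pair)
    have wm: "(\<lambda>z. (v z, u z, q z)) \<in> borel_measurable lebesgue"
      using in_X_D(1)[OF assms(4)] by (simp add: Linfty_def)
    have [measurable]: "v \<in> borel_measurable lebesgue" "q \<in> borel_measurable lebesgue"
      using borel_measurable_continuous_on[OF continuous_on_fst[OF continuous_on_id] wm]
        borel_measurable_continuous_on[OF continuous_on_snd[OF continuous_on_snd[OF continuous_on_id]] wm]
      by simp_all
    show "(\<lambda>z. (v z, p z)) \<in> borel_measurable lebesgue"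
      unfolding assms(6) by (intro borel_measurable_Pair) measurable
    \<comment> \<open>The constant is the sum of the bounds \<open>1\<close> for the velocity and
      \<open>2\<close> for the pressure.\<close>
    show "norm (vk k z, pk k z) \<le> 3 * indicator \<Omega> z" for k z
    proof (cases "z \<in> \<Omega>")
      case True
      then show ?thesis using norm_Pair_le[of "vk k z" "pk k z"] v1[of k z] pb[of k z] by simp
    next
      case False
      then have "z \<notin> S k" using S\<Omega> by blast
      then show ?thesis using v0 p0 by simp
    qed
    show "AE z in lebesgue. (\<lambda>k. (vk k z, pk k z)) \<longlonglongrightarrow> (v z, p z)"
      using limv limp by eventually_elim (rule tendsto_Pair)
  qed
  show ?thesis
    by (intro exI[of _ vk] exI[of _ fk] exI[of _ pk] conjI allI impI bdd conv H vC fC pC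
      conjunct1[OF eqs] conjunct2[OF eqs])
qed

end
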